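(* Let $A$ and $B$ be smooth vector fields on a smooth manifold $M$ and let a family of 2-jets of curves on $M$ be given by $$\gamma_x(t)=\Phi_A^{t^2}\big(\Phi_B^t(x)\big).$$ Choose a coordinate chart and let $A^i$, $B^i$ be the components of $A$ and $B$ in this chart. Then, in this chart, for each $x$ the curve $\gamma_x$ has the same 2-jet at $t=0$ as the curve $$t\mapsto x+a(x)\,t^2+b(x)\,t,$$ where $$a^i=A^i+\frac12\sum_j\frac{\partial B^i}{\partial x^j}B^j,\qquad b^i=B^i .$$
   Context: $\Phi_A^s$ denotes the (local) flow of the vector field $A$ at time $s$, and $\Phi_A^{t^2}$ is this flow at time $s=t^2$ (the square of $t$). Two curves have the same 2-jet at $t=0$ if in coordinates their Taylor expansions at $t=0$ agree up to and including order $t^2$. *)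

theory Defs
  imports "HOL-Analysis.Analysis"
begin

(* Meant for open S only. Together with the Frechet differentiability demanded at each earlier stage,
   continuity of all iterated directional derivatives of order at most k is the usual C^k. *)
primrec Ck_on :: "'a::real_normed_vector set \<Rightarrow> ('a \<Rightarrow> 'b::real_normed_vector) \<Rightarrow> nat \<Rightarrow> bool" where
  "Ck_on S f 0 \<longleftrightarrow> continuous_on S f"
| "Ck_on S f (Suc k) \<longleftrightarrow>
     (\<forall>x\<in>S. f differentiable (at x)) \<and>
     (\<forall>v. Ck_on S (\<lambda>x. frechet_derivative f (at x) v) k)"

definition smooth_on :: "'a::real_normed_vector set \<Rightarrow> ('a \<Rightarrow> 'b::real_normed_vector) \<Rightarrow> bool" where
  "smooth_on S f \<longleftrightarrow> (\<forall>k. Ck_on S f k)"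

(* A chart is a pair (U, phi); the values of phi outside U are irrelevant.
   Its inverse on phi ` U is inv_into U phi. *)
type_synonym ('a, 'n) chart = "'a set \<times> ('a \<Rightarrow> real ^ 'n)"

definition is_chart :: "'a topology \<Rightarrow> ('a, 'n::finite) chart \<Rightarrow> bool" where
  "is_chart M = (\<lambda>(U, \<phi>). openin M U \<and> open (\<phi> ` U) \<and>
     homeomorphic_map (subtopology M U) (top_of_set (\<phi> ` U)) \<phi>)"

definition transition :: "('a, 'n::finite) chart \<Rightarrow> ('a, 'n) chart \<Rightarrow> real ^ 'n \<Rightarrow> real ^ 'n" where
  "transition c c' = snd c' \<circ> inv_into (fst c) (snd c)"

definition compatible :: "('a, 'n::finite) chart \<Rightarrow> ('a, 'n) chart \<Rightarrow> bool" where
  "compatible c c' \<longleftrightarrow>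
     smooth_on (snd c ` (fst c \<inter> fst c')) (transition c c') \<and>
     smooth_on (snd c' ` (fst c \<inter> fst c')) (transition c' c)"

(* The smooth structure is a maximal smooth atlas, so that its members are all the charts of M. *)
definition smooth_manifold :: "'a topology \<Rightarrow> ('a, 'n::finite) chart set \<Rightarrow> bool" where
  "smooth_manifold M \<A> \<longleftrightarrow>
     Hausdorff_space M \<and> second_countable M \<and>
     (\<forall>c\<in>\<A>. is_chart M c) \<and>
     (\<Union>c\<in>\<A>. fst c) = topspace M \<and>
     (\<forall>c\<in>\<A>. \<forall>c'\<in>\<A>. compatible c c') \<and>
     (\<forall>c. is_chart M c \<and> (\<forall>c'\<in>\<A>. compatible c c') \<longrightarrow> c \<in> \<A>)"

(* A tangent vector at p assigns to each chart around p a tuple of components, which transform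
   by the differential of the coordinate changes. Values on charts not containing p are irrelevant. *)
type_synonym ('a, 'n) tangent = "('a, 'n) chart \<Rightarrow> real ^ 'n"

definition tangent_vector :: "('a, 'n::finite) chart set \<Rightarrow> 'a \<Rightarrow> ('a, 'n) tangent \<Rightarrow> bool" where
  "tangent_vector \<A> p v \<longleftrightarrow>
     (\<forall>c\<in>\<A>. \<forall>c'\<in>\<A>. p \<in> fst c \<and> p \<in> fst c' \<longrightarrow>
        v c' = frechet_derivative (transition c c') (at (snd c p)) (v c))"

definition chart_components :: "('a \<Rightarrow> ('a, 'n::finite) tangent) \<Rightarrow> ('a, 'n) chart \<Rightarrow> real ^ 'n \<Rightarrow> real ^ 'n" where
  "chart_components X c \<xi> = X (inv_into (fst c) (snd c) \<xi>) c"

definition smooth_vector_field ::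
    "'a topology \<Rightarrow> ('a, 'n::finite) chart set \<Rightarrow> ('a \<Rightarrow> ('a, 'n) tangent) \<Rightarrow> bool" where
  "smooth_vector_field M \<A> X \<longleftrightarrow>
     (\<forall>p\<in>topspace M. tangent_vector \<A> p (X p)) \<and>
     (\<forall>c\<in>\<A>. smooth_on (snd c ` fst c) (chart_components X c))"

definition has_velocity ::
    "('a, 'n::finite) chart set \<Rightarrow> (real \<Rightarrow> 'a) \<Rightarrow> ('a, 'n) tangent \<Rightarrow> real \<Rightarrow> bool" where
  "has_velocity \<A> \<sigma> v s \<longleftrightarrow>
     (\<forall>c\<in>\<A>. \<sigma> s \<in> fst c \<longrightarrow> ((snd c \<circ> \<sigma>) has_vector_derivative v c) (at s))"

definition integral_curve ::
    "'a topology \<Rightarrow> ('a, 'n::finite) chart set \<Rightarrow> ('a \<Rightarrow> ('a, 'n) tangent) \<Rightarrow>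
     real set \<Rightarrow> (real \<Rightarrow> 'a) \<Rightarrow> bool" where
  "integral_curve M \<A> X J \<sigma> \<longleftrightarrow>
     open J \<and> is_interval J \<and> continuous_map (top_of_set J) M \<sigma> \<and>
     (\<forall>s\<in>J. has_velocity \<A> \<sigma> (X (\<sigma> s)) s)"

definition flows_to ::
    "'a topology \<Rightarrow> ('a, 'n::finite) chart set \<Rightarrow> ('a \<Rightarrow> ('a, 'n) tangent) \<Rightarrow>
     real \<Rightarrow> 'a \<Rightarrow> 'a \<Rightarrow> bool" where
  "flows_to M \<A> X s x y \<longleftrightarrow>
     (\<exists>J \<sigma>. integral_curve M \<A> X J \<sigma> \<and> 0 \<in> J \<and> s \<in> J \<and> \<sigma> 0 = x \<and> \<sigma> s = y)"

(* The flow with its maximal domain of definition flow_domain; the value of flow outside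
   this domain is meaningless. *)
definition flow_domain ::
    "'a topology \<Rightarrow> ('a, 'n::finite) chart set \<Rightarrow> ('a \<Rightarrow> ('a, 'n) tangent) \<Rightarrow> (real \<times> 'a) set" where
  "flow_domain M \<A> X = {(s, x). \<exists>y. flows_to M \<A> X s x y}"

definition flow ::
    "'a topology \<Rightarrow> ('a, 'n::finite) chart set \<Rightarrow> ('a \<Rightarrow> ('a, 'n) tangent) \<Rightarrow> real \<Rightarrow> 'a \<Rightarrow> 'a" where
  "flow M \<A> X s x = (THE y. flows_to M \<A> X s x y)"

(* c0, c1, c2 are the Taylor coefficients of f at 0, i.e. f(0), f'(0), f''(0)/2. *)
definition has_taylor2 ::
    "(real \<Rightarrow> 'b::real_normed_vector) \<Rightarrow> 'b \<Rightarrow> 'b \<Rightarrow> 'b \<Rightarrow> bool" where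
  "has_taylor2 f c0 c1 c2 \<longleftrightarrow>
     (\<exists>f'. (\<forall>\<^sub>F t in nhds 0. (f has_vector_derivative f' t) (at t)) \<and>
           f 0 = c0 \<and> f' 0 = c1 \<and> (f' has_vector_derivative 2 *\<^sub>R c2) (at 0))"

definition same_2jet :: "(real \<Rightarrow> 'b::real_normed_vector) \<Rightarrow> (real \<Rightarrow> 'b) \<Rightarrow> bool" where
  "same_2jet f g \<longleftrightarrow> (\<exists>c0 c1 c2. has_taylor2 f c0 c1 c2 \<and> has_taylor2 g c0 c1 c2)"

definition partial_deriv :: "'n::finite \<Rightarrow> (real ^ 'n \<Rightarrow> real) \<Rightarrow> real ^ 'n \<Rightarrow> real" where
  "partial_deriv j g \<xi> = deriv (\<lambda>h. g (\<xi> + h *\<^sub>R axis j 1)) 0"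

end

theory Submission
  imports Defs
begin

text \<open>In the chart, let \<open>y\<close> be the integral curve of \<open>B\<close> through \<open>x\<close> and let \<open>u t s\<close> be the flow of \<open>A\<close> at
  time \<open>s\<close> from \<open>y t\<close>. Solving the first-order system \<open>u' = A u, w' = DA(u) w\<close> with initial value
  \<open>(y t, B (y t))\<close> yields the flow together with its derivative \<open>w t s\<close> along \<open>y\<close>, so that
  \<open>f t = u t (t\<^sup>2)\<close> has the derivative \<open>2 t A(f t) + w t (t\<^sup>2)\<close> near \<open>0\<close>. Since \<open>w t s = B (y t) + O(s)\<close>,
  the derivative of the latter at \<open>0\<close> is \<open>2 A(x) + DB(x) B(x)\<close>. All estimates are made on time
  intervals so short that a mean value estimate replaces Gronwall's inequality.\<close>

section \<open>Bounds from derivatives\<close>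

text \<open>\<open>has_taylor2\<close> asks for a derivative at every t near 0, so an expansion at 0
  alone does not suffice: the diagonal curve \<open>u t (t^2)\<close>, whose parameter moves both
  the initial value and the flow time, has to be differentiated at all small t. This is achieved
  along the single curve of initial values \<open>y\<close>, uniformly in the flow time, with
  \<open>w\<close> as the candidate derivative; \<open>w\<close> starts at B(y t) because that is
  the velocity of \<open>y\<close>. Short-time existence comes with one lifetime for all initial
  values in a ball, so all \<open>u t\<close> live on a common interval. DA enters the derivative of
  \<open>f\<close> only to order t^2: through 2 t A(f t), where the factor t is already present, and
  through \<open>w\<close>, which runs for time t^2 only. This is why DA is absent from the result
  while DB is present. On the manifold, \<open>flow\<close> is a definite description, so solutions
  found in the chart determine it only once integral curves are unique on the whole common interval,
  and this is where the Hausdorff property enters.\<close>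

lemma norm_diff_le_vector_derivative_bound:
  fixes f :: "real \<Rightarrow> 'a::real_normed_vector"
  assumes "convex S"
    and "\<And>t. t \<in> S \<Longrightarrow> (f has_vector_derivative f' t) (at t within S)"
    and "\<And>t. t \<in> S \<Longrightarrow> norm (f' t) \<le> B"
    and "s \<in> S" "t \<in> S"
  shows "norm (f s - f t) \<le> B * \<bar>s - t\<bar>"
proof -
  have "norm (f s - f t) \<le> B * norm (s - t)"
  proof (rule differentiable_bound[OF assms(1)])
    show "(f has_derivative (\<lambda>h. h *\<^sub>R f' x)) (at x within S)" if "x \<in> S" for x
      using assms(2)[OF that] by (simp add: has_vector_derivative_def)
    show "onorm (\<lambda>h. h *\<^sub>R f' x) \<le> B" if "x \<in> S" for x
      using mult_right_mono[OF assms(3)[OF that] abs_ge_zero]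
      by (intro onorm_le) (simp add: mult.commute)
  qed (use assms in auto)
  then show ?thesis by simp
qed

lemma linear_eq_sum_Basis:
  fixes f :: "'a::euclidean_space \<Rightarrow> 'b::real_vector"
  assumes "linear f"
  shows "f v = (\<Sum>b\<in>Basis. (v \<bullet> b) *\<^sub>R f b)"
proof -
  have "f v = f (\<Sum>b\<in>Basis. (v \<bullet> b) *\<^sub>R b)"
    by (simp add: euclidean_representation)
  then show ?thesis
    by (simp add: linear_sum[OF assms] linear_scale[OF assms])
qed

text \<open>\<open>Ck_on\<close> gives continuity of the derivative one direction at a time.
  Expanding \<open>v\<close> in the finite basis turns the bounds for the basis directions into one
  operator bound.\<close>

lemma Ck_on_bound_frechet_derivative:
  fixes f :: "'a::euclidean_space \<Rightarrow> 'b::real_normed_vector"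
  assumes f: "Ck_on S f (Suc 0)" and C: "compact C" "C \<subseteq> S"
  obtains K where "K \<ge> 0"
    "\<And>x v. x \<in> C \<Longrightarrow> norm (frechet_derivative f (at x) v) \<le> K * norm v"
proof -
  have "\<exists>k. \<forall>x\<in>C. norm (frechet_derivative f (at x) b) \<le> k" for b
  proof -
    have "continuous_on C (\<lambda>x. frechet_derivative f (at x) b)"
      using f C by (auto intro: continuous_on_subset)
    then have "bounded ((\<lambda>x. frechet_derivative f (at x) b) ` C)"
      using C(1) compact_continuous_image compact_imp_bounded by blast
    then show ?thesis by (auto simp: bounded_iff)
  qed
  then obtain k where k: "\<And>x b. x \<in> C \<Longrightarrow> norm (frechet_derivative f (at x) b) \<le> k b"
    by metis
  \<comment> \<open>The bounds \<open>k b\<close> may be negative when \<open>C\<close> is empty;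
    the absolute values secure \<open>K \<ge> 0\<close>.\<close>
  define K where "K = (\<Sum>b\<in>Basis. \<bar>k b\<bar>)"
  have "norm (frechet_derivative f (at x) v) \<le> K * norm v" if "x \<in> C" for x v
  proof -
    have "linear (frechet_derivative f (at x))"
      using f that C by (auto intro: linear_frechet_derivative)
    then have "frechet_derivative f (at x) v
        = (\<Sum>b\<in>Basis. (v \<bullet> b) *\<^sub>R frechet_derivative f (at x) b)"
      by (rule linear_eq_sum_Basis)
    also have "norm \<dots> \<le> (\<Sum>b\<in>Basis. norm v * \<bar>k b\<bar>)"
    proof (rule order_trans[OF norm_sum], rule sum_mono)
      fix b :: 'a assume "b \<in> Basis"
      then have "\<bar>v \<bullet> b\<bar> \<le> norm v" by (rule Basis_le_norm)
      moreover have "norm (frechet_derivative f (at x) b) \<le> \<bar>k b\<bar>"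
        using k[OF that] by (metis abs_ge_self order_trans)
      ultimately show "norm ((v \<bullet> b) *\<^sub>R frechet_derivative f (at x) b) \<le> norm v * \<bar>k b\<bar>"
        by (auto intro: mult_mono)
    qed
    finally show ?thesis by (simp add: K_def sum_distrib_left mult.commute sum_distrib_right)
  qed
  moreover have "K \<ge> 0" by (simp add: K_def sum_nonneg)
  ultimately show thesis using that by blast
qed

lemma norm_diff_le_frechet_derivative_bound:
  fixes f :: "'a::euclidean_space \<Rightarrow> 'b::real_normed_vector"
  assumes "\<And>x. x \<in> C \<Longrightarrow> f differentiable (at x)" and "convex C"
    and "\<And>x v. x \<in> C \<Longrightarrow> norm (frechet_derivative f (at x) v) \<le> K * norm v"
    and "x \<in> C" "y \<in> C"
  shows "norm (f x - f y) \<le> K * norm (x - y)"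
proof (rule differentiable_bound[OF \<open>convex C\<close>])
  show "(f has_derivative frechet_derivative f (at x)) (at x within C)" if "x \<in> C" for x
    using assms(1)[OF that] frechet_derivative_works has_derivative_at_withinI by blast
  show "onorm (frechet_derivative f (at x)) \<le> K" if "x \<in> C" for x
    by (rule onorm_le) (rule assms(3)[OF that])
qed (use assms in auto)

lemma Ck_on_lipschitz_bound:
  fixes f :: "'a::euclidean_space \<Rightarrow> 'b::real_normed_vector"
  assumes f: "Ck_on S f (Suc 0)" and C: "compact C" "convex C" "C \<subseteq> S"
  obtains L where "0 \<le> L"
    "\<And>x y. x \<in> C \<Longrightarrow> y \<in> C \<Longrightarrow> norm (f x - f y) \<le> L * norm (x - y)"
proof -
  obtain L where L: "L \<ge> 0" "\<And>x v. x \<in> C \<Longrightarrow> norm (frechet_derivative f (at x) v) \<le> L * norm v"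
    using Ck_on_bound_frechet_derivative[OF f C(1,3)] by metis
  have "f differentiable (at x)" if "x \<in> C" for x using f C(3) that by auto
  from that[OF L(1) norm_diff_le_frechet_derivative_bound[OF this C(2) L(2)]] show thesis .
qed

text \<open>Each directional derivative of a C^2 map is C^1, hence Lipschitz on \<open>C\<close>;
  the basis expansion again makes this uniform in \<open>v\<close>. The bound serves twice: for the
  Lipschitz property of the variational field and for quadratic Taylor remainders.\<close>

lemma Ck_on_bound_frechet_derivative_diff:
  fixes f :: "'a::euclidean_space \<Rightarrow> 'b::real_normed_vector"
  assumes f: "Ck_on S f (Suc (Suc 0))" and C: "compact C" "convex C" "C \<subseteq> S"
  obtains K where "K \<ge> 0"
    "\<And>x y v. x \<in> C \<Longrightarrow> y \<in> C \<Longrightarrow>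
      norm (frechet_derivative f (at x) v - frechet_derivative f (at y) v)
        \<le> K * norm (x - y) * norm v"
proof -
  let ?D = "\<lambda>v x. frechet_derivative f (at x) v"
  have Ck: "Ck_on S (?D v) (Suc 0)" for v
    using f by simp
  have "\<exists>k\<ge>0. \<forall>x\<in>C. \<forall>y\<in>C. norm (?D b x - ?D b y) \<le> k * norm (x - y)" for b
    using Ck_on_lipschitz_bound[OF Ck C] by metis
  then obtain k where k: "\<And>b. k b \<ge> 0"
    "\<And>x y b. x \<in> C \<Longrightarrow> y \<in> C \<Longrightarrow> norm (?D b x - ?D b y) \<le> k b * norm (x - y)"
    by metis
  define K where "K = (\<Sum>b\<in>Basis. k b)"
  have "norm (?D v x - ?D v y) \<le> K * norm (x - y) * norm v" if "x \<in> C" "y \<in> C" for x y v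
  proof -
    have D: "?D v x = (\<Sum>b\<in>Basis. (v \<bullet> b) *\<^sub>R ?D b x)" if "x \<in> C" for x
    proof -
      have "linear (frechet_derivative f (at x))"
        using f that C by (auto intro: linear_frechet_derivative)
      then show ?thesis by (rule linear_eq_sum_Basis)
    qed
    have "?D v x - ?D v y = (\<Sum>b\<in>Basis. (v \<bullet> b) *\<^sub>R (?D b x - ?D b y))"
      using that by (simp add: D[of x] D[of y] scaleR_diff_right sum_subtractf)
    also have "norm \<dots> \<le> (\<Sum>b\<in>Basis. norm v * (k b * norm (x - y)))"
    proof (rule order_trans[OF norm_sum], rule sum_mono)
      fix b :: 'a assume "b \<in> Basis"
      then have "\<bar>v \<bullet> b\<bar> \<le> norm v" by (rule Basis_le_norm)
      then show "norm ((v \<bullet> b) *\<^sub>R (?D b x - ?D b y)) \<le> norm v * (k b * norm (x - y))"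
        using k that by (auto intro!: mult_mono)
    qed
    finally show ?thesis
      by (simp add: K_def sum_distrib_left sum_distrib_right mult_ac)
  qed
  moreover have "K \<ge> 0" using k by (simp add: K_def sum_nonneg)
  ultimately show thesis using that by blast
qed

section \<open>Short-time existence and uniqueness for ordinary differential equations\<close>

text \<open>The condition \<open>e * L \<le> 1 / 2\<close> makes the Picard map a contraction with
  factor 1/2 in the supremum distance, for every initial value \<open>z\<close>.\<close>

lemma picard_global:
  fixes G :: "'a::euclidean_space \<Rightarrow> 'a"
  assumes lip: "\<And>x y. norm (G x - G y) \<le> L * norm (x - y)" and e: "0 < e" "e * L \<le> 1 / 2"
    and "0 \<le> L"
  obtains X where "X 0 = z"
    "\<And>t. t \<in> {-e..e} \<Longrightarrow> (X has_vector_derivative G (X t)) (at t within {-e..e})"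
proof -
  let ?J = "{-e..e}"
  \<comment> \<open>The integral starts at -e; subtracting \<open>I g 0\<close> in \<open>P\<close>
    yields the integral from 0 to t with the right sign also for negative t.\<close>
  define I where "I g t = integral {-e..t} (\<lambda>s. G (apply_bcontfun g s))" for g t
  \<comment> \<open>Freezing time outside [-e, e] lets the Picard map act on all bounded continuous
    functions on the line, a complete space.\<close>
  define cl where "cl t = max (-e) (min e t)" for t
  define P where "P g t = z + I g t - I g 0" for g t
  have cl: "cl t \<in> ?J" for t using e by (auto simp: cl_def)
  have cl_id: "cl t = t" if "t \<in> ?J" for t using that by (auto simp: cl_def)
  have contG: "continuous_on UNIV G"
  proof -
    have "L-lipschitz_on UNIV G"
      using lip \<open>0 \<le> L\<close> by (intro lipschitz_onI) (auto simp: dist_norm)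
    then show ?thesis by (rule lipschitz_on_continuous_on)
  qed
  have dP: "(P g has_vector_derivative G (apply_bcontfun g t)) (at t within ?J)" if "t \<in> ?J" for g t
  proof -
    have "continuous_on ?J (\<lambda>s. G (apply_bcontfun g s))"
      by (rule continuous_on_compose2[OF contG]) auto
    from integral_has_vector_derivative[OF this that] show ?thesis
      unfolding P_def[abs_def] I_def[abs_def]
      by (auto intro!: derivative_eq_intros)
  qed
  have "(\<lambda>t. P g (cl t)) \<in> bcontfun" for g
  proof -
    have "continuous_on ?J (P g)"
      unfolding continuous_on_eq_continuous_within
      using dP has_vector_derivative_continuous by blast
    moreover have "continuous_on UNIV cl" unfolding cl_def by (intro continuous_intros)
    ultimately have "continuous_on UNIV (\<lambda>t. P g (cl t))"
      by (rule continuous_on_compose2) (use cl in auto)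
    moreover have "bounded (range (\<lambda>t. P g (cl t)))"
    proof (rule bounded_subset)
      show "bounded (P g ` ?J)"
        using \<open>continuous_on ?J (P g)\<close> compact_continuous_image compact_imp_bounded by blast
    qed (use cl in auto)
    ultimately show ?thesis by (simp add: bcontfun_def)
  qed
  then have T: "apply_bcontfun (Bcontfun (\<lambda>t. P g (cl t))) = (\<lambda>t. P g (cl t))" for g
    by (rule Bcontfun_inverse)
  define T where "T g = Bcontfun (\<lambda>t. P g (cl t))" for g
  have "\<exists>!g. T g = g"
  proof (rule banach_fix_type)
    show "\<forall>g h. dist (T g) (T h) \<le> 1 / 2 * dist g h"
    proof (intro allI)
      fix g h
      show "dist (T g) (T h) \<le> 1 / 2 * dist g h"
      proof (rule dist_bound)
        fix t
        \<comment> \<open>The contraction estimate is the mean value inequality for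
          \<open>P g - P h\<close>, which vanishes at 0 because both curves start at
          \<open>z\<close>.\<close>
        have "norm ((P g (cl t) - P h (cl t)) - (P g 0 - P h 0)) \<le> (L * dist g h) * \<bar>cl t - 0\<bar>"
        proof (rule norm_diff_le_vector_derivative_bound[of ?J])
          fix s assume "s \<in> ?J"
          then show "((\<lambda>t. P g t - P h t) has_vector_derivative
              (G (apply_bcontfun g s) - G (apply_bcontfun h s))) (at s within ?J)"
            by (intro derivative_intros dP)
          have "norm (G (apply_bcontfun g s) - G (apply_bcontfun h s))
              \<le> L * dist (apply_bcontfun g s) (apply_bcontfun h s)"
            using lip by (simp add: dist_norm)
          also have "\<dots> \<le> L * dist g h"
            using \<open>0 \<le> L\<close> by (intro mult_left_mono dist_bounded)
          finally show "norm (G (apply_bcontfun g s) - G (apply_bcontfun h s)) \<le> L * dist g h" .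
        qed (use e cl in auto)
        also have "\<dots> \<le> (L * dist g h) * e"
          using cl[of t] \<open>0 \<le> L\<close> by (intro mult_left_mono) auto
        also have "\<dots> \<le> 1 / 2 * dist g h"
          using mult_right_mono[OF e(2), of "dist g h"] by (simp add: mult_ac)
        finally show "dist (apply_bcontfun (T g) t) (apply_bcontfun (T h) t) \<le> 1 / 2 * dist g h"
          unfolding T_def T by (simp add: dist_norm P_def)
      qed
    qed
  qed auto
  then obtain g where g: "T g = g" by blast
  have gP: "apply_bcontfun g t = P g t" if "t \<in> ?J" for t
    using T[of g] g cl_id[OF that] by (metis T_def)
  show thesis
  proof
    show "P g 0 = z" by (simp add: P_def)
    show "(P g has_vector_derivative G (P g t)) (at t within ?J)" if "t \<in> ?J" for t
      using dP[OF that, of g] gP[OF that] by simp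
  qed
qed

text \<open>Precomposing with the nearest-point projection onto the ball makes the field globally Lipschitz.\<close>
lemma picard_local:
  fixes F :: "'a::euclidean_space \<Rightarrow> 'a"
  assumes lip: "\<And>x y. x \<in> cball z0 R \<Longrightarrow> y \<in> cball z0 R \<Longrightarrow> norm (F x - F y) \<le> L * norm (x - y)"
    and R: "0 < R" and L: "0 \<le> L"
  obtains e where "0 < e"
    "\<And>z. z \<in> cball z0 (R / 2) \<Longrightarrow> \<exists>X. X 0 = z \<and>
      (\<forall>t\<in>ball 0 e. X t \<in> cball z0 R \<and> (X has_vector_derivative F (X t)) (at t))"
proof -
  let ?C = "cball z0 R"
  let ?p = "closest_point ?C"
  define M where "M = norm (F z0) + L * R"
  have M: "norm (F x) \<le> M" if "x \<in> ?C" for x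
  proof -
    have "norm (F x - F z0) \<le> L * norm (x - z0)" using that R by (intro lip) auto
    also have "\<dots> \<le> L * R" using that L by (intro mult_left_mono) (auto simp: dist_norm norm_minus_commute)
    finally show ?thesis unfolding M_def by (smt (verit) norm_triangle_ineq2)
  qed
  have M0: "0 \<le> M" using L R by (simp add: M_def)
  \<comment> \<open>The first bound yields the contraction. The second keeps the displacement below
    R/2, so every solution starting in the half ball stays in the ball; \<open>e\<close> is
    therefore independent of the initial value. Adding 1 keeps the denominators positive.\<close>
  define e where "e = min (1 / (2 * (L + 1))) (R / (2 * (M + 1)))"
  have e0: "0 < e" using L R M0 by (simp add: e_def)
  have eL: "e * L \<le> 1 / 2"
  proof -
    have "e * L \<le> (1 / (2 * (L + 1))) * L" using L by (intro mult_right_mono) (auto simp: e_def)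
    also have "\<dots> \<le> 1 / 2" using L by (simp add: field_simps)
    finally show ?thesis .
  qed
  have eM: "M * e \<le> R / 2"
  proof -
    have "M * e \<le> M * (R / (2 * (M + 1)))" using M0 by (intro mult_left_mono) (auto simp: e_def)
    also have "\<dots> \<le> R / 2" using M0 R by (simp add: field_simps)
    finally show ?thesis .
  qed
  have pC: "?p x \<in> ?C" for x using R by (intro closest_point_in_set) auto
  have p_id: "?p x = x" if "x \<in> ?C" for x using that by (rule closest_point_self)
  have "norm (F (?p x) - F (?p y)) \<le> L * norm (x - y)" for x y
  proof -
    have "norm (F (?p x) - F (?p y)) \<le> L * norm (?p x - ?p y)" by (intro lip pC)
    also have "\<dots> \<le> L * norm (x - y)"
      using closest_point_lipschitz[of ?C x y] R L by (intro mult_left_mono) (auto simp: dist_norm)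
    finally show ?thesis .
  qed
  note G = picard_global[where G = "\<lambda>x. F (?p x)", OF this e0 eL L]
  show thesis
  proof (rule that[OF e0])
    fix z assume z: "z \<in> cball z0 (R / 2)"
    obtain X where X: "X 0 = z"
      "\<And>t. t \<in> {-e..e} \<Longrightarrow> (X has_vector_derivative F (?p (X t))) (at t within {-e..e})"
      using G by metis
    \<comment> \<open>The projected field is bounded by \<open>M\<close> everywhere, so this
      estimate does not presuppose that \<open>X\<close> stays in the ball; it shows it, and thereby
      that \<open>X\<close> solves the original equation.\<close>
    have XC: "X t \<in> ?C" if "t \<in> {-e..e}" for t
    proof -
      have "norm (X t - X 0) \<le> M * \<bar>t - 0\<bar>"
        by (rule norm_diff_le_vector_derivative_bound[of "{-e..e}", OF _ X(2)])
          (use M pC that e0 in auto)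
      also have "\<dots> \<le> M * e" using that M0 by (intro mult_left_mono) auto
      finally have "dist z (X t) \<le> R / 2" using eM X(1) by (simp add: dist_norm norm_minus_commute)
      then show ?thesis using z dist_triangle[of z0 "X t" z] by simp
    qed
    have "(X has_vector_derivative F (X t)) (at t)" if "t \<in> ball 0 e" for t
    proof -
      have t: "t \<in> {-e..e}" "t \<in> interior {-e..e}" using that by (auto simp: dist_norm)
      then have "at t within {-e..e} = at t" by (intro at_within_interior)
      then show ?thesis using X(2)[OF t(1)] p_id[OF XC[OF t(1)]] by simp
    qed
    then show "\<exists>X. X 0 = z \<and> (\<forall>t\<in>ball 0 e. X t \<in> ?C \<and> (X has_vector_derivative F (X t)) (at t))"
      using X(1) XC by (intro exI[of _ X]) (auto simp: dist_norm abs_less_iff)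
  qed
qed

text \<open>Since \<open>r * L \<le> 1 / 2\<close>, the growth term is at most half of the supremum
  of \<open>norm (d t)\<close> and is absorbed into the left side, whence the factor 2. Boundedness
  of \<open>d\<close> makes that supremum finite, so that it can be subtracted.\<close>

lemma short_time_gronwall:
  fixes d :: "real \<Rightarrow> 'a::real_normed_vector"
  assumes d: "\<And>t. t \<in> ball s r \<Longrightarrow> (d has_vector_derivative d' t) (at t)"
    and d': "\<And>t. t \<in> ball s r \<Longrightarrow> norm (d' t) \<le> L * norm (d t) + k"
    and bdd: "bounded (d ` ball s r)" and L: "0 \<le> L" "r * L \<le> 1 / 2"
    and k: "0 \<le> k" and t: "t \<in> ball s r"
  shows "norm (d t) \<le> 2 * (norm (d s) + r * k)"
proof -
  let ?B = "ball s r"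
  have r: "0 < r" using t by (metis ball_eq_empty empty_iff not_le)
  define D where "D = (SUP t\<in>?B. norm (d t))"
  have bdd': "bdd_above ((\<lambda>t. norm (d t)) ` ?B)"
    using bdd by (auto simp: bounded_iff bdd_above_def)
  have D: "norm (d t) \<le> D" if "t \<in> ?B" for t
    unfolding D_def using that bdd' by (rule cSUP_upper)
  have D0: "0 \<le> D" using D[OF t] by (meson norm_ge_zero order_trans)
  have "norm (d t) \<le> norm (d s) + (D / 2 + r * k)" if "t \<in> ?B" for t
  proof -
    have "norm (d t - d s) \<le> (L * D + k) * \<bar>t - s\<bar>"
    proof (rule norm_diff_le_vector_derivative_bound[of ?B])
      fix u assume u: "u \<in> ?B"
      show "(d has_vector_derivative d' u) (at u within ?B)"
        using d[OF u] by (rule has_vector_derivative_at_within)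
      have "norm (d' u) \<le> L * norm (d u) + k" using d'[OF u] .
      also have "\<dots> \<le> L * D + k" using D[OF u] L by (intro add_right_mono mult_left_mono)
      finally show "norm (d' u) \<le> L * D + k" .
    qed (use that r in auto)
    also have "\<dots> \<le> (L * D + k) * r"
      using that L D0 k by (intro mult_left_mono) (auto simp: dist_real_def)
    also have "\<dots> \<le> D / 2 + r * k"
      using mult_right_mono[OF L(2) D0] by (simp add: algebra_simps)
    finally show ?thesis by (smt (verit) norm_triangle_sub)
  qed
  then have "D \<le> norm (d s) + (D / 2 + r * k)"
    unfolding D_def using r by (intro cSUP_least) auto
  then show ?thesis using D[OF t] by simp
qed

section \<open>Differentiating a flow along a curve of initial values\<close>

lemma Ck_on_2_imp_1: "Ck_on S f (Suc (Suc 0)) \<Longrightarrow> Ck_on S f (Suc 0)"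
  by (auto simp: differentiable_imp_continuous_within continuous_on_eq_continuous_within
      continuous_at_imp_continuous_within)

text \<open>The pair (u, w) is an integral curve of the tangent lift \<open>F\<close> of
  \<open>f\<close>. \<open>F\<close> is Lipschitz on a product ball because \<open>f\<close> is C^2
  and the vector component is bounded there. Solving for both at once gives a common lifetime for
  all initial pairs in the half ball and a bound for \<open>w\<close>.\<close>

lemma variational_solutions:
  fixes f :: "'a::euclidean_space \<Rightarrow> 'a"
  assumes f: "Ck_on S f (Suc (Suc 0))" and R: "0 < R" "cball x0 R \<subseteq> S"
  obtains e where "0 < e"
    "\<And>z. z \<in> cball (x0, v0) (R / 2) \<Longrightarrow> \<exists>u w. u 0 = fst z \<and> w 0 = snd z \<and>
      (\<forall>s\<in>ball 0 e. u s \<in> cball x0 R \<and> norm (w s) \<le> norm v0 + R \<and>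
        (u has_vector_derivative f (u s)) (at s) \<and>
        (w has_vector_derivative frechet_derivative f (at (u s)) (w s)) (at s))"
proof -
  let ?C = "cball x0 R" and ?Z = "cball (x0, v0) R"
  let ?D = "\<lambda>x. frechet_derivative f (at x)"
  define F where "F z = (f (fst z), ?D (fst z) (snd z))" for z
  define W where "W = norm v0 + R"
  have C: "compact ?C" "convex ?C" by auto
  have f1: "Ck_on S f (Suc 0)" using f by (rule Ck_on_2_imp_1)
  obtain K where K: "K \<ge> 0" "\<And>x v. x \<in> ?C \<Longrightarrow> norm (?D x v) \<le> K * norm v"
    using Ck_on_bound_frechet_derivative[OF f1 C(1) R(2)] by metis
  obtain K' where K': "K' \<ge> 0"
    "\<And>x y v. x \<in> ?C \<Longrightarrow> y \<in> ?C \<Longrightarrow> norm (?D x v - ?D y v) \<le> K' * norm (x - y) * norm v"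
    using Ck_on_bound_frechet_derivative_diff[OF f C R(2)] by metis
  have W: "0 \<le> W" using R by (simp add: W_def)
  have diff: "f differentiable (at x)" if "x \<in> ?C" for x using f1 R(2) that by auto
  have Z: "fst z \<in> ?C \<and> norm (snd z) \<le> W" if "z \<in> ?Z" for z
  proof -
    have "dist x0 (fst z) \<le> R" "dist v0 (snd z) \<le> R"
      using that dist_fst_le[of "(x0, v0)" z] dist_snd_le[of "(x0, v0)" z] by auto
    then show ?thesis
      unfolding W_def by (auto simp: dist_norm) (smt (verit) norm_minus_commute norm_triangle_sub)
  qed
  have lip: "norm (F z - F z') \<le> (2 * K + K' * W) * norm (z - z')" if z: "z \<in> ?Z" "z' \<in> ?Z" for z z'
  proof -
    obtain x v x' v' where eq: "z = (x, v)" "z' = (x', v')" by (metis surj_pair)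
    have x: "x \<in> ?C" "x' \<in> ?C" "norm v' \<le> W"
      using Z[OF z(1)] Z[OF z(2)] by (auto simp: eq)
    have nx: "norm (x - x') \<le> norm (z - z')" "norm (v - v') \<le> norm (z - z')"
      using norm_fst_le[of "x - x'" "v - v'"] norm_snd_le[of "v - v'" "x - x'"] by (auto simp: eq)
    have "norm (f x - f x') \<le> K * norm (x - x')"
      using norm_diff_le_frechet_derivative_bound[of ?C f K x x'] diff K(2) x by auto
    also have "\<dots> \<le> K * norm (z - z')" using nx K by (intro mult_left_mono)
    finally have 1: "norm (f x - f x') \<le> K * norm (z - z')" .
    \<comment> \<open>The vector is changed first, at a fixed base point, and then the base point;
      the second change costs the factor \<open>W\<close> that bounds \<open>v'\<close>.\<close>
    have "?D x v - ?D x' v' = ?D x (v - v') + (?D x v' - ?D x' v')"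
      using linear_diff[OF linear_frechet_derivative[OF diff[OF x(1)]]] by simp
    then have "norm (?D x v - ?D x' v') \<le> norm (?D x (v - v')) + norm (?D x v' - ?D x' v')"
      by (metis norm_triangle_ineq)
    also have "\<dots> \<le> K * norm (v - v') + K' * norm (x - x') * norm v'"
      using K(2)[OF x(1)] K'(2)[OF x(1,2)] by (intro add_mono)
    also have "\<dots> \<le> K * norm (z - z') + K' * norm (z - z') * W"
      using nx x K K' by (intro add_mono mult_mono mult_left_mono) auto
    finally have 2: "norm (?D x v - ?D x' v') \<le> K * norm (z - z') + K' * norm (z - z') * W" .
    have "norm (F z - F z') \<le> norm (f x - f x') + norm (?D x v - ?D x' v')"
      using norm_Pair_le[of "f x - f x'" "?D x v - ?D x' v'"] by (simp add: F_def eq)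
    also have "\<dots> \<le> (2 * K + K' * W) * norm (z - z')"
      using 1 2 by (simp add: algebra_simps)
    finally show ?thesis .
  qed
  have "0 \<le> 2 * K + K' * W" using K K' W by simp
  from picard_local[OF lip R(1) this] obtain e where e: "0 < e"
    "\<And>z. z \<in> cball (x0, v0) (R / 2) \<Longrightarrow> \<exists>X. X 0 = z \<and>
      (\<forall>t\<in>ball 0 e. X t \<in> ?Z \<and> (X has_vector_derivative F (X t)) (at t))"
    by metis
  show thesis
  proof (rule that[OF e(1)])
    fix z assume "z \<in> cball (x0, v0) (R / 2)"
    then obtain X where X: "X 0 = z" "\<And>t. t \<in> ball 0 e \<Longrightarrow> X t \<in> ?Z"
      "\<And>t. t \<in> ball 0 e \<Longrightarrow> (X has_vector_derivative F (X t)) (at t)"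
      using e(2) by metis
    show "\<exists>u w. u 0 = fst z \<and> w 0 = snd z \<and>
      (\<forall>s\<in>ball 0 e. u s \<in> cball x0 R \<and> norm (w s) \<le> norm v0 + R \<and>
        (u has_vector_derivative f (u s)) (at s) \<and>
        (w has_vector_derivative frechet_derivative f (at (u s)) (w s)) (at s))"
    proof (rule exI[of _ "\<lambda>s. fst (X s)"], rule exI[of _ "\<lambda>s. snd (X s)"], intro conjI ballI)
      fix s :: real assume s: "s \<in> ball 0 e"
      show "fst (X s) \<in> ?C" "norm (snd (X s)) \<le> norm v0 + R"
        using Z[OF X(2)[OF s]] by (auto simp: W_def)
      show "((\<lambda>s. fst (X s)) has_vector_derivative f (fst (X s))) (at s)"
        using bounded_linear.has_vector_derivative[OF bounded_linear_fst X(3)[OF s]] by (simp add: F_def)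
      show "((\<lambda>s. snd (X s)) has_vector_derivative ?D (fst (X s)) (snd (X s))) (at s)"
        using bounded_linear.has_vector_derivative[OF bounded_linear_snd X(3)[OF s]] by (simp add: F_def)
    qed (simp_all add: X(1))
  qed
qed

section \<open>Derivatives as little-o estimates, and the derivative of the diagonal curve\<close>

lemma has_vector_derivative_iff_norm_tendsto:
  "(g has_vector_derivative d) (at t) \<longleftrightarrow>
    ((\<lambda>r. norm (g r - g t - (r - t) *\<^sub>R d) / \<bar>r - t\<bar>) \<longlongrightarrow> 0) (at t)"
proof -
  have "(g has_vector_derivative d) (at t) \<longleftrightarrow>
      ((\<lambda>r. (g r - g t - (r - t) *\<^sub>R d) /\<^sub>R \<bar>r - t\<bar>) \<longlongrightarrow> 0) (at t)"
    by (simp add: has_vector_derivative_def has_derivative_at_within bounded_linear_scaleR_left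
        diff_diff_eq)
  also have "\<dots> \<longleftrightarrow> ((\<lambda>r. norm ((g r - g t - (r - t) *\<^sub>R d) /\<^sub>R \<bar>r - t\<bar>)) \<longlongrightarrow> 0) (at t)"
    by (rule tendsto_norm_zero_iff[symmetric])
  also have "\<dots> \<longleftrightarrow> ((\<lambda>r. norm (g r - g t - (r - t) *\<^sub>R d) / \<bar>r - t\<bar>) \<longlongrightarrow> 0) (at t)"
    by (simp add: divide_inverse mult.commute)
  finally show ?thesis .
qed

text \<open>A sum of an o(|r - t|) term and an O(|r - t|^2) term is o(|r - t|). It is applied to the
  linearisation error, with \<open>h\<close> its value at flow time 0, and with \<open>c = 0\<close>
  to purely quadratic errors.\<close>

lemma has_vector_derivative_zero_dominated:
  fixes g :: "real \<Rightarrow> 'a::real_normed_vector" and h :: "real \<Rightarrow> 'b::real_normed_vector"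
  assumes h: "(h has_vector_derivative 0) (at t)" "h t = 0" and g: "g t = 0"
    and le: "\<forall>\<^sub>F r in at t. norm (g r) \<le> c * norm (h r) + k * \<bar>r - t\<bar>\<^sup>2"
  shows "(g has_vector_derivative 0) (at t)"
proof -
  have "((\<lambda>r. norm (h r) / \<bar>r - t\<bar>) \<longlongrightarrow> 0) (at t)"
    using h by (simp add: has_vector_derivative_iff_norm_tendsto)
  moreover have "((\<lambda>r. \<bar>r - t\<bar>) \<longlongrightarrow> \<bar>t - t\<bar>) (at t)" by (intro tendsto_intros)
  ultimately have "((\<lambda>r. c * (norm (h r) / \<bar>r - t\<bar>) + k * \<bar>r - t\<bar>) \<longlongrightarrow> c * 0 + k * \<bar>t - t\<bar>) (at t)"
    by (intro tendsto_intros)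
  then have lim: "((\<lambda>r. c * (norm (h r) / \<bar>r - t\<bar>) + k * \<bar>r - t\<bar>) \<longlongrightarrow> 0) (at t)" by simp
  have "((\<lambda>r. norm (g r) / \<bar>r - t\<bar>) \<longlongrightarrow> 0) (at t)"
  proof (rule tendsto_sandwich[OF _ _ tendsto_const lim])
    have "\<forall>\<^sub>F r in at t. r \<noteq> t" by (simp add: eventually_at_filter)
    with le show "\<forall>\<^sub>F r in at t. norm (g r) / \<bar>r - t\<bar> \<le> c * (norm (h r) / \<bar>r - t\<bar>) + k * \<bar>r - t\<bar>"
    proof eventually_elim
      case (elim r)
      then have "norm (g r) / \<bar>r - t\<bar> \<le> (c * norm (h r) + k * \<bar>r - t\<bar>\<^sup>2) / \<bar>r - t\<bar>"
        by (intro divide_right_mono) auto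
      also have "\<dots> = c * (norm (h r) / \<bar>r - t\<bar>) + k * \<bar>r - t\<bar>"
        using elim by (simp add: field_simps power2_eq_square)
      finally show ?case .
    qed
  qed simp
  then show ?thesis
    using g by (simp add: has_vector_derivative_iff_norm_tendsto)
qed

lemma power2_in_ball:
  fixes t :: real
  assumes "t \<in> ball 0 r" "r \<le> 1"
  shows "t\<^sup>2 \<in> ball 0 r"
proof -
  have "\<bar>t\<bar> * \<bar>t\<bar> \<le> \<bar>t\<bar> * 1" using assms by (intro mult_left_mono) auto
  then show ?thesis using assms by (simp add: power2_eq_square flip: abs_mult)
qed

text \<open>For t' near t, \<open>u t' (t'^2)\<close> is the sum of \<open>u t (t'^2)\<close>,
  \<open>(t' - t) w(t'^2)\<close> and an error. The first term is a chain rule along one fixed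
  solution. The second has derivative \<open>w (t^2)\<close> at t, because its factor t' - t
  vanishes there. The error is o(|t' - t|) uniformly in the flow time, so it may be evaluated at the
  moving time t'^2.\<close>

lemma flow_along_curve_has_vector_derivative:
  fixes f :: "'a::euclidean_space \<Rightarrow> 'a" and u :: "real \<Rightarrow> real \<Rightarrow> 'a"
  assumes diff: "\<And>x. x \<in> C \<Longrightarrow> f differentiable (at x)" and C: "compact C" "convex C"
    and K: "K \<ge> 0" "\<And>x v. x \<in> C \<Longrightarrow> norm (frechet_derivative f (at x) v) \<le> K * norm v"
    and K': "K' \<ge> 0" "\<And>x y v. x \<in> C \<Longrightarrow> y \<in> C \<Longrightarrow>
      norm (frechet_derivative f (at x) v - frechet_derivative f (at y) v)
        \<le> K' * norm (x - y) * norm v"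
    and r: "r * K \<le> 1 / 2" "r \<le> 1"
    and uC: "\<And>t s. t \<in> ball 0 r \<Longrightarrow> s \<in> ball 0 r \<Longrightarrow> u t s \<in> C"
    and du: "\<And>t s. t \<in> ball 0 r \<Longrightarrow> s \<in> ball 0 r \<Longrightarrow>
      (u t has_vector_derivative f (u t s)) (at s)"
    and t: "t \<in> ball 0 r"
    and w: "\<And>s. s \<in> ball 0 r \<Longrightarrow> norm (w s) \<le> W"
    and dw: "\<And>s. s \<in> ball 0 r \<Longrightarrow>
      (w has_vector_derivative frechet_derivative f (at (u t s)) (w s)) (at s)"
    and dy: "((\<lambda>t. u t 0) has_vector_derivative w 0) (at t)"
  shows "((\<lambda>t. u t (t\<^sup>2)) has_vector_derivative (2 * t) *\<^sub>R f (u t (t\<^sup>2)) + w (t\<^sup>2)) (at t)"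
proof -
  let ?J = "ball (0::real) r"
  let ?D = "\<lambda>x. frechet_derivative f (at x)"
  have r0: "0 < r" using t by (metis ball_eq_empty empty_iff not_le)
  have J0: "0 \<in> ?J" using r0 by simp
  have sq: "h\<^sup>2 \<in> ?J" if "h \<in> ?J" for h
    using power2_in_ball[OF that r(2)] .
  have bddC: "bounded C" using C compact_imp_bounded by blast
  then obtain c where c: "\<And>x. x \<in> C \<Longrightarrow> norm x \<le> c" by (auto simp: bounded_iff)
  have linD: "linear (?D x)" if "x \<in> C" for x
    using linear_frechet_derivative[OF diff[OF that]] .
  have Df: "(f has_derivative ?D x) (at x)" if "x \<in> C" for x
    using diff[OF that] frechet_derivative_works by blast
  \<comment> \<open>Lipschitz dependence on the initial value, uniform in the flow time; it later
    makes the Taylor remainder quadratic in the initial distance.\<close>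
  have step: "norm (u t' s - u t s) \<le> 2 * norm (u t' 0 - u t 0)" if t': "t' \<in> ?J" and s: "s \<in> ?J" for t' s
  proof -
    have "norm (u t' s - u t s) \<le> 2 * (norm (u t' 0 - u t 0) + r * 0)"
    proof (rule short_time_gronwall[where L = K and d' = "\<lambda>s. f (u t' s) - f (u t s)"])
      fix s assume s: "s \<in> ?J"
      show "((\<lambda>s. u t' s - u t s) has_vector_derivative f (u t' s) - f (u t s)) (at s)"
        using du s t t' by (intro derivative_intros)
      show "norm (f (u t' s) - f (u t s)) \<le> K * norm (u t' s - u t s) + 0"
        using norm_diff_le_frechet_derivative_bound[OF diff C(2) K(2)] uC s t t' by simp
    next
      have "norm (u t' s - u t s) \<le> 2 * c" if "s \<in> ?J" for s
        using c[OF uC[OF t' that]] c[OF uC[OF t that]] norm_triangle_ineq4[of "u t' s" "u t s"] by simp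
      then show "bounded ((\<lambda>s. u t' s - u t s) ` ?J)" by (intro boundedI[of _ "2 * c"]) auto
    qed (use K r s in auto)
    then show ?thesis by simp
  qed
  \<comment> \<open>The error of the linearisation; it solves the variational equation up to a quadratic term.\<close>
  define e where "e t' s = u t' s - u t s - (t' - t) *\<^sub>R w s" for t' s
  have e: "norm (e t' s) \<le> 2 * norm (e t' 0) + 8 * r * K' * (norm (u t' 0 - u t 0))\<^sup>2"
    if t': "t' \<in> ?J" and s: "s \<in> ?J" for t' s
  proof -
    \<comment> \<open>The 4 is the square of the factor 2 in \<open>step\<close>; the short-time
      bound then contributes 2 * r, which gives the 8 * r in the claim.\<close>
    let ?k = "4 * K' * (norm (u t' 0 - u t 0))\<^sup>2"
    have "norm (e t' s) \<le> 2 * (norm (e t' 0) + r * ?k)"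
    proof (rule short_time_gronwall[where L = K and
          d' = "\<lambda>s. f (u t' s) - f (u t s) - (t' - t) *\<^sub>R ?D (u t s) (w s)"])
      fix s assume s: "s \<in> ?J"
      let ?x = "u t s" and ?x' = "u t' s"
      have x: "?x \<in> C" "?x' \<in> C" using uC t t' s by auto
      show "(e t' has_vector_derivative f ?x' - f ?x - (t' - t) *\<^sub>R ?D ?x (w s)) (at s)"
        unfolding e_def[abs_def]
        using du[OF t s] du[OF t' s] dw[OF s]
        by (intro has_vector_derivative_diff bounded_linear.has_vector_derivative[OF bounded_linear_scaleR_right])
      \<comment> \<open>First-order Taylor remainder: on the segment, which lies in the convex set
        \<open>C\<close>, the derivative differs from its value at \<open>?x\<close> by at most
        \<open>K'\<close> times the length of the segment.\<close>
      have "norm (f ?x' - f ?x - ?D ?x (?x' - ?x)) \<le> norm (?x' - ?x) * (K' * norm (?x' - ?x))"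
      proof (rule differentiable_bound_linearization[where S = "closed_segment ?x ?x'" and f' = ?D])
        have seg: "closed_segment ?x ?x' \<subseteq> C" using x C(2) by (rule closed_segment_subset)
        show "(f has_derivative ?D z) (at z within closed_segment ?x ?x')" if "z \<in> closed_segment ?x ?x'" for z
          using Df seg that has_derivative_at_withinI by blast
        show "onorm (?D z - ?D ?x) \<le> K' * norm (?x' - ?x)" if "z \<in> closed_segment ?x ?x'" for z
        proof (rule onorm_le)
          fix v
          have "norm ((?D z - ?D ?x) v) \<le> K' * norm (z - ?x) * norm v"
            using K'(2) seg that x by auto
          also have "\<dots> \<le> K' * norm (?x' - ?x) * norm v"
            using K' segment_bound[OF that] by (intro mult_left_mono mult_right_mono) auto
          finally show "norm ((?D z - ?D ?x) v) \<le> K' * norm (?x' - ?x) * norm v" .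
        qed
        show "?x + p *\<^sub>R (?x' - ?x) \<in> closed_segment ?x ?x'" if "p \<in> {0..1}" for p
          using that unfolding closed_segment_def by (auto simp: algebra_simps intro!: exI[of _ p])
      qed auto
      also have "\<dots> = K' * (norm (?x' - ?x))\<^sup>2" by (simp add: power2_eq_square)
      also have "\<dots> \<le> K' * (2 * norm (u t' 0 - u t 0))\<^sup>2"
        using step[OF t' s] K' by (intro mult_left_mono power_mono) auto
      finally have lin: "norm (f ?x' - f ?x - ?D ?x (?x' - ?x)) \<le> ?k" by (simp add: power_mult_distrib)
      have "f ?x' - f ?x - (t' - t) *\<^sub>R ?D ?x (w s) = ?D ?x (e t' s) + (f ?x' - f ?x - ?D ?x (?x' - ?x))"
        by (simp add: e_def linear_diff[OF linD[OF x(1)]] linear_scale[OF linD[OF x(1)]])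
      then have "norm (f ?x' - f ?x - (t' - t) *\<^sub>R ?D ?x (w s))
          \<le> norm (?D ?x (e t' s)) + norm (f ?x' - f ?x - ?D ?x (?x' - ?x))"
        by (metis norm_triangle_ineq)
      also have "\<dots> \<le> K * norm (e t' s) + ?k"
        using K(2)[OF x(1)] lin by (intro add_mono)
      finally show "norm (f ?x' - f ?x - (t' - t) *\<^sub>R ?D ?x (w s)) \<le> K * norm (e t' s) + ?k" .
    next
      \<comment> \<open>A crude bound, whose purpose is to make the supremum in
        \<open>short_time_gronwall\<close> finite.\<close>
      have "norm (e t' s) \<le> 2 * c + \<bar>t' - t\<bar> * W" if "s \<in> ?J" for s
      proof -
        have "norm (e t' s) \<le> norm (u t' s) + norm (u t s) + \<bar>t' - t\<bar> * norm (w s)"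
          unfolding e_def by (metis add_right_mono norm_scaleR norm_triangle_ineq4 order_trans real_norm_def)
        also have "\<dots> \<le> c + c + \<bar>t' - t\<bar> * W"
          using c[OF uC[OF t' that]] c[OF uC[OF t that]] w[OF that] by (intro add_mono mult_left_mono) auto
        finally show ?thesis by simp
      qed
      then show "bounded (e t' ` ?J)" by (intro boundedI[of _ "2 * c + \<bar>t' - t\<bar> * W"]) auto
    qed (use K K' r s in auto)
    then show ?thesis by (simp add: algebra_simps)
  qed
  have near: "\<forall>\<^sub>F t' in at t. t' \<in> ?J"
    using t by (intro eventually_at_in_open') auto
  have "\<forall>\<^sub>F t' in at t. norm (u t' 0 - u t 0) \<le> (norm (w 0) + 1) * \<bar>t' - t\<bar>"
  proof -
    \<comment> \<open>Differentiability of the initial values at t bounds their distance by a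
      multiple of |t' - t|, with 1 as slack; this turns the squared initial distance into (t' -
      t)^2.\<close>
    have "((\<lambda>t'. norm (u t' 0 - u t 0 - (t' - t) *\<^sub>R w 0) / \<bar>t' - t\<bar>) \<longlongrightarrow> 0) (at t)"
      using dy by (simp only: has_vector_derivative_iff_norm_tendsto)
    then have "\<forall>\<^sub>F t' in at t. norm (u t' 0 - u t 0 - (t' - t) *\<^sub>R w 0) / \<bar>t' - t\<bar> < 1"
      by (rule order_tendstoD) simp
    moreover have "\<forall>\<^sub>F t' in at t. t' \<noteq> t" by (simp add: eventually_at_filter)
    ultimately show ?thesis
    proof eventually_elim
      case (elim t')
      then have "norm (u t' 0 - u t 0 - (t' - t) *\<^sub>R w 0) \<le> \<bar>t' - t\<bar>" by (simp add: field_simps)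
      moreover have "norm (u t' 0 - u t 0) \<le> norm (u t' 0 - u t 0 - (t' - t) *\<^sub>R w 0) + norm ((t' - t) *\<^sub>R w 0)"
        by (metis diff_add_cancel norm_triangle_ineq)
      ultimately have "norm (u t' 0 - u t 0) \<le> \<bar>t' - t\<bar> + norm ((t' - t) *\<^sub>R w 0)" by linarith
      then show ?case by (simp add: distrib_left distrib_right ac_simps)
    qed
  qed
  with near have "\<forall>\<^sub>F t' in at t. norm (e t' (t'\<^sup>2))
      \<le> 2 * norm (e t' 0) + (8 * r * K' * (norm (w 0) + 1)\<^sup>2) * \<bar>t' - t\<bar>\<^sup>2"
  proof eventually_elim
    case (elim t')
    have "8 * r * K' * (norm (u t' 0 - u t 0))\<^sup>2 \<le> 8 * r * K' * ((norm (w 0) + 1) * \<bar>t' - t\<bar>)\<^sup>2"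
      using elim r0 K' by (intro mult_left_mono power_mono) auto
    then show ?case
      using e[OF elim(1) sq[OF elim(1)]] by (simp only: power_mult_distrib mult.assoc)
  qed
  then have de: "((\<lambda>t'. e t' (t'\<^sup>2)) has_vector_derivative 0) (at t)"
  proof (rule has_vector_derivative_zero_dominated[rotated 3])
    have "((\<lambda>t'. u t' 0 - u t 0 - (t' - t) *\<^sub>R w 0) has_vector_derivative w 0 - 0 - (1 - 0) *\<^sub>R w 0) (at t)"
      by (auto intro!: derivative_eq_intros dy)
    then show "((\<lambda>t'. e t' 0) has_vector_derivative 0) (at t)" by (simp add: e_def)
  qed (simp_all add: e_def)
  have sq': "((\<lambda>t. t\<^sup>2) has_real_derivative 2 * t) (at t)"
    by (auto intro!: derivative_eq_intros)
  have dusq: "((\<lambda>t'. u t (t'\<^sup>2)) has_vector_derivative (2 * t) *\<^sub>R f (u t (t\<^sup>2))) (at t)"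
    using vector_diff_chain_at[OF sq'[unfolded has_real_derivative_iff_has_vector_derivative] du[OF t sq[OF t]]]
    by (simp add: o_def)
  have dwsq: "((\<lambda>t'. w (t'\<^sup>2)) has_vector_derivative (2 * t) *\<^sub>R ?D (u t (t\<^sup>2)) (w (t\<^sup>2))) (at t)"
    using vector_diff_chain_at[OF sq'[unfolded has_real_derivative_iff_has_vector_derivative] dw[OF sq[OF t]]]
    by (simp add: o_def)
  have "((\<lambda>t'. t' - t) has_real_derivative 1) (at t)" by (auto intro!: derivative_eq_intros)
  from has_vector_derivative_scaleR[OF this dwsq]
  have "((\<lambda>t'. (t' - t) *\<^sub>R w (t'\<^sup>2)) has_vector_derivative w (t\<^sup>2)) (at t)" by simp
  from has_vector_derivative_add[OF has_vector_derivative_add[OF dusq this] de]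
  show ?thesis by (simp add: e_def)
qed

section \<open>The second-order expansion in coordinates\<close>

lemma has_vector_derivative_compose_frechet:
  assumes "(y has_vector_derivative y') (at t)" "f differentiable (at (y t))"
  shows "((\<lambda>t. f (y t)) has_vector_derivative frechet_derivative f (at (y t)) y') (at t)"
proof -
  have "(f has_derivative frechet_derivative f (at (y t))) (at (y t) within range y)"
    using assms(2) frechet_derivative_works has_derivative_at_withinI by blast
  from vector_derivative_diff_chain_within[OF assms(1) this] show ?thesis by (simp add: o_def)
qed

text \<open>The solutions \<open>y\<close> and \<open>u\<close> are returned along with the
  expansion, because they are later carried to the manifold as integral curves. \<open>f\<close> is
  C^2 for the variational equation; \<open>g\<close> is C^1 for solving for \<open>y\<close> and
  differentiating its velocity.\<close>

lemma flow_square_along_flow_taylor2: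
  fixes f g :: "'a::euclidean_space \<Rightarrow> 'a"
  assumes f: "Ck_on S f (Suc (Suc 0))" and g: "Ck_on S g (Suc 0)" and S: "open S" "x0 \<in> S"
  obtains r y u where "0 < r" "r \<le> 1" "y 0 = x0"
    "\<And>t. t \<in> ball 0 r \<Longrightarrow> y t \<in> S \<and> (y has_vector_derivative g (y t)) (at t)"
    "\<And>t. t \<in> ball 0 r \<Longrightarrow> u t 0 = y t"
    "\<And>t s. t \<in> ball 0 r \<Longrightarrow> s \<in> ball 0 r \<Longrightarrow>
      u t s \<in> S \<and> (u t has_vector_derivative f (u t s)) (at s)"
    "has_taylor2 (\<lambda>t. u t (t\<^sup>2)) x0 (g x0)
      (f x0 + (1 / 2) *\<^sub>R frechet_derivative g (at x0) (g x0))"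
proof -
  obtain R where R: "0 < R" "cball x0 R \<subseteq> S" using S open_contains_cball by blast
  let ?C = "cball x0 R"
  let ?D = "\<lambda>x. frechet_derivative f (at x)"
  have C: "compact ?C" "convex ?C" by auto
  have f1: "Ck_on S f (Suc 0)" using f by (rule Ck_on_2_imp_1)
  have diff: "f differentiable (at x)" "g differentiable (at x)" if "x \<in> S" for x
    using f1 g that by auto
  obtain K where K: "K \<ge> 0" "\<And>x v. x \<in> ?C \<Longrightarrow> norm (?D x v) \<le> K * norm v"
    using Ck_on_bound_frechet_derivative[OF f1 C(1) R(2)] by metis
  obtain K' where K': "K' \<ge> 0"
    "\<And>x y v. x \<in> ?C \<Longrightarrow> y \<in> ?C \<Longrightarrow> norm (?D x v - ?D y v) \<le> K' * norm (x - y) * norm v"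
    using Ck_on_bound_frechet_derivative_diff[OF f C R(2)] by metis
  obtain Kg where Kg: "0 \<le> Kg"
    "\<And>x z. x \<in> ?C \<Longrightarrow> z \<in> ?C \<Longrightarrow> norm (g x - g z) \<le> Kg * norm (x - z)"
    using Ck_on_lipschitz_bound[OF g C R(2)] by metis
  from picard_local[OF Kg(2) R(1) Kg(1)] obtain r1 where r1: "0 < r1"
    "\<And>z. z \<in> cball x0 (R / 2) \<Longrightarrow> \<exists>X. X 0 = z \<and>
      (\<forall>t\<in>ball 0 r1. X t \<in> ?C \<and> (X has_vector_derivative g (X t)) (at t))"
    by metis
  have "x0 \<in> cball x0 (R / 2)" using R by simp
  from r1(2)[OF this] obtain y where y: "y 0 = x0" "\<And>t. t \<in> ball 0 r1 \<Longrightarrow> y t \<in> ?C"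
    "\<And>t. t \<in> ball 0 r1 \<Longrightarrow> (y has_vector_derivative g (y t)) (at t)" by blast
  obtain r2 where r2: "0 < r2"
    "\<And>z. z \<in> cball (x0, g x0) (R / 2) \<Longrightarrow> \<exists>u w. u 0 = fst z \<and> w 0 = snd z \<and>
      (\<forall>s\<in>ball 0 r2. u s \<in> ?C \<and> norm (w s) \<le> norm (g x0) + R \<and>
        (u has_vector_derivative f (u s)) (at s) \<and>
        (w has_vector_derivative ?D (u s) (w s)) (at s))"
    using variational_solutions[OF f R] by metis
  have dy0: "(y has_vector_derivative g x0) (at 0)" using y(3)[of 0] r1(1) y(1) by simp
  then have ycont: "isCont y 0" by (rule has_vector_derivative_continuous)
  have dgy: "((\<lambda>t. g (y t)) has_vector_derivative frechet_derivative g (at x0) (g x0)) (at 0)"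
    using has_vector_derivative_compose_frechet[OF dy0, of g] diff(2) S(2) y(1) by simp
  then have gcont: "isCont (\<lambda>t. g (y t)) 0" by (rule has_vector_derivative_continuous)
  \<comment> \<open>By continuity the initial pairs stay, for small t, in the half ball on which all
    solutions share the lifetime \<open>r2\<close>.\<close>
  have "isCont (\<lambda>t. (y t, g (y t))) 0" using ycont gcont by (intro continuous_intros)
  then obtain r3 where r3: "0 < r3"
    "\<And>t. t \<in> ball 0 r3 \<Longrightarrow> (y t, g (y t)) \<in> cball (x0, g x0) (R / 2)"
  proof -
    have "0 < R / 2" using R by simp
    then obtain d where "0 < d"
      "\<And>t. dist t 0 < d \<Longrightarrow> dist (y t, g (y t)) (y 0, g (y 0)) < R / 2"
      using \<open>isCont (\<lambda>t. (y t, g (y t))) 0\<close> unfolding continuous_at_eps_delta by blast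
    then show thesis
      using y(1) by (intro that[of d]) (auto simp: dist_commute intro: less_imp_le)
  qed
  \<comment> \<open>\<open>r1\<close> and \<open>r2\<close> are lifetimes, \<open>r3\<close> keeps
    the initial pairs in the half ball, 1 ensures |t^2| < r whenever |t| < r, and the last entry
    gives \<open>r * K \<le> 1 / 2\<close>.\<close>
  define r where "r = Min {r1, r2, r3, 1, 1 / (2 * (K + 1))}"
  have r: "0 < r" "r \<le> r1" "r \<le> r2" "r \<le> r3" "r \<le> 1"
    using r1(1) r2(1) r3(1) K(1) by (auto simp: r_def min_le_iff_disj)
  have "r * K \<le> 1 / (2 * (K + 1)) * K" using K by (intro mult_right_mono) (auto simp: r_def)
  also have "\<dots> \<le> 1 / 2" using K by (simp add: field_simps)
  finally have rK: "r * K \<le> 1 / 2" .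
  let ?J = "ball (0::real) r"
  define sol where "sol t u w \<longleftrightarrow> u 0 = y t \<and> w 0 = g (y t) \<and>
      (\<forall>s\<in>?J. u s \<in> ?C \<and> norm (w s) \<le> norm (g x0) + R \<and>
        (u has_vector_derivative f (u s)) (at s) \<and>
        (w has_vector_derivative ?D (u s) (w s)) (at s))" for t u w
  have "\<exists>u w. sol t u w" if "t \<in> ?J" for t
    unfolding sol_def using r2(2)[OF r3(2)[of t]] that r by fastforce
  then obtain u w where sol: "\<And>t. t \<in> ?J \<Longrightarrow> sol t (u t) (w t)" by metis
  have uw0: "u t 0 = y t" "w t 0 = g (y t)" if "t \<in> ?J" for t
    using sol[OF that] by (auto simp: sol_def)
  have uC: "u t s \<in> ?C" and w: "norm (w t s) \<le> norm (g x0) + R"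
    and du: "(u t has_vector_derivative f (u t s)) (at s)"
    and dw: "(w t has_vector_derivative ?D (u t s) (w t s)) (at s)"
    if "t \<in> ?J" "s \<in> ?J" for t s
    using sol[OF that(1)] that(2) by (auto simp: sol_def)
  have J0: "0 \<in> ?J" using r by simp
  let ?f = "\<lambda>t. u t (t\<^sup>2)"
  let ?f' = "\<lambda>t. (2 * t) *\<^sub>R f (?f t) + w t (t\<^sup>2)"
  have df: "(?f has_vector_derivative ?f' t) (at t)" if t: "t \<in> ?J" for t
  proof (rule flow_along_curve_has_vector_derivative[where C = ?C and u = u and w = "w t"
        and K = K and K' = K' and r = r and W = "norm (g x0) + R"])
    show "f differentiable (at x)" if "x \<in> ?C" for x using diff(1) R(2) that by blast
    have "(y has_vector_derivative w t 0) (at t)" using y(3)[of t] uw0(2)[OF t] t r by simp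
    then show "((\<lambda>t. u t 0) has_vector_derivative w t 0) (at t)"
      by (rule has_vector_derivative_transform_within_open[where S = ?J]) (use t uw0 in auto)
  qed (fact C K K' rK r(5) t uC[OF _ _] du[OF _ _] w[OF t] dw[OF t])+
  have nz: "\<forall>\<^sub>F t in nhds 0. t \<in> ?J" using J0 by (intro eventually_nhds_in_open) auto
  have u00: "u 0 0 = x0" "w 0 0 = g x0" using uw0 J0 y(1) by auto
  define W where "W = norm (g x0) + R"
  \<comment> \<open>The speed of \<open>w t\<close> is at most \<open>K * W\<close> and it runs only
    for time t^2, so its evolution changes the first derivative of the curve by O(t^2) and leaves
    the second derivative at 0 to \<open>g (y t)\<close>.\<close>
  have wdiff: "norm (w t (t\<^sup>2) - g (y t)) \<le> (K * W) * \<bar>t - 0\<bar>\<^sup>2" if t: "t \<in> ?J" for t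
  proof -
    have sq: "t\<^sup>2 \<in> ?J" using t r by (intro power2_in_ball)
    have "norm (w t (t\<^sup>2) - w t 0) \<le> (K * W) * \<bar>t\<^sup>2 - 0\<bar>"
    proof (rule norm_diff_le_vector_derivative_bound[of ?J])
      fix s assume s: "s \<in> ?J"
      show "(w t has_vector_derivative ?D (u t s) (w t s)) (at s within ?J)"
        using dw[OF t s] by (rule has_vector_derivative_at_within)
      have "norm (?D (u t s) (w t s)) \<le> K * norm (w t s)" using K(2) uC[OF t s] by blast
      also have "\<dots> \<le> K * W" using w[OF t s] K by (intro mult_left_mono) (auto simp: W_def)
      finally show "norm (?D (u t s) (w t s)) \<le> K * W" .
    qed (use sq J0 in auto)
    then show ?thesis using uw0(2)[OF t] by simp
  qed
  have d1: "((\<lambda>t. w t (t\<^sup>2) - g (y t)) has_vector_derivative 0) (at 0)"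
  proof (rule has_vector_derivative_zero_dominated[where c = 0 and k = "K * W"])
    show "((\<lambda>_. 0::real) has_vector_derivative 0) (at 0)" by simp
    have "\<forall>\<^sub>F t in at 0. t \<in> ?J" using J0 by (intro eventually_at_in_open') auto
    then show "\<forall>\<^sub>F t in at 0. norm (w t (t\<^sup>2) - g (y t)) \<le> 0 * norm (0::real) + K * W * \<bar>t - 0\<bar>\<^sup>2"
      by eventually_elim (use wdiff in auto)
  qed (use u00 y(1) in auto)
  have "((\<lambda>t. f (?f t)) has_vector_derivative ?D (?f 0) (?f' 0)) (at 0)"
    using df[OF J0] by (rule has_vector_derivative_compose_frechet) (use diff u00 S in auto)
  moreover have "((\<lambda>t::real. 2 * t) has_real_derivative 2) (at 0)" by (auto intro!: derivative_eq_intros)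
  \<comment> \<open>In the product rule the term with the derivative of \<open>f\<close> along the
    curve carries the factor 2 t, which is 0 at t = 0.\<close>
  ultimately have d2: "((\<lambda>t. (2 * t) *\<^sub>R f (?f t)) has_vector_derivative 2 *\<^sub>R f x0) (at 0)"
    using has_vector_derivative_scaleR[of "\<lambda>t. 2 * t" 2 0 UNIV "\<lambda>t. f (?f t)"] u00 by auto
  \<comment> \<open>The second derivative is 2 f(x0) + Dg(x0) g(x0); halving it to a Taylor
    coefficient produces the 1/2.\<close>
  have "(?f' has_vector_derivative 2 *\<^sub>R (f x0 + (1 / 2) *\<^sub>R frechet_derivative g (at x0) (g x0))) (at 0)"
    using has_vector_derivative_add[OF d2 has_vector_derivative_add[OF d1 dgy]]
    by (simp add: scaleR_add_right)
  moreover have "\<forall>\<^sub>F t in nhds 0. (?f has_vector_derivative ?f' t) (at t)"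
    using nz by eventually_elim (rule df)
  ultimately have taylor: "has_taylor2 ?f x0 (g x0) (f x0 + (1 / 2) *\<^sub>R frechet_derivative g (at x0) (g x0))"
    unfolding has_taylor2_def using u00 by (intro exI[of _ ?f']) auto
  show thesis
  proof (rule that[OF r(1,5) y(1) _ uw0(1) _ taylor])
    show "y t \<in> S \<and> (y has_vector_derivative g (y t)) (at t)" if "t \<in> ?J" for t
      using y(2,3)[of t] R(2) that r by auto
    show "u t s \<in> S \<and> (u t has_vector_derivative f (u t s)) (at s)" if "t \<in> ?J" "s \<in> ?J" for t s
      using uC[OF that] du[OF that] R(2) by auto
  qed
qed

section \<open>Second-order Taylor coefficients\<close>

text \<open>Equality near 0 is equality near every t close to 0, which is what transfers the
  derivative at those t as well.\<close>

lemma has_taylor2_cong: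
  assumes f: "has_taylor2 f c0 c1 c2" and eq: "\<forall>\<^sub>F t in nhds 0. f t = g t"
  shows "has_taylor2 g c0 c1 c2"
proof -
  obtain f' where f': "\<forall>\<^sub>F t in nhds 0. (f has_vector_derivative f' t) (at t)"
    "f 0 = c0" "f' 0 = c1" "(f' has_vector_derivative 2 *\<^sub>R c2) (at 0)"
    using f unfolding has_taylor2_def by blast
  have "\<forall>\<^sub>F t in nhds 0. \<forall>\<^sub>F s in nhds t. f s = g s" using eq by (simp add: eventually_eventually)
  with f'(1) have "\<forall>\<^sub>F t in nhds 0. (g has_vector_derivative f' t) (at t)"
  proof eventually_elim
    case (elim t)
    then have "f t = g t" by (auto dest: eventually_nhds_x_imp_x)
    with elim show ?case
      using has_vector_derivative_cong_ev[of UNIV f g t "f' t"] by simp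
  qed
  moreover have "g 0 = c0" using eq f'(2) by (auto dest: eventually_nhds_x_imp_x)
  ultimately show ?thesis unfolding has_taylor2_def using f' by blast
qed

lemma has_taylor2_quadratic:
  "has_taylor2 (\<lambda>t. x + t\<^sup>2 *\<^sub>R a + t *\<^sub>R b) x b a"
  unfolding has_taylor2_def
proof (intro exI[of _ "\<lambda>t. (2 * t) *\<^sub>R a + b"] conjI always_eventually allI)
  fix t :: real
  have "((\<lambda>t. t\<^sup>2) has_real_derivative 2 * t) (at t)" "((\<lambda>t::real. t) has_real_derivative 1) (at t)"
    by (auto intro!: derivative_eq_intros)
  from has_vector_derivative_scaleR[OF this(1) has_vector_derivative_const[of a]]
    has_vector_derivative_scaleR[OF this(2) has_vector_derivative_const[of b]]
  show "((\<lambda>t. x + t\<^sup>2 *\<^sub>R a + t *\<^sub>R b) has_vector_derivative (2 * t) *\<^sub>R a + b) (at t)"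
    by (auto intro!: derivative_eq_intros)
next
  have "((\<lambda>t::real. 2 * t) has_real_derivative 2) (at 0)" by (auto intro!: derivative_eq_intros)
  from has_vector_derivative_scaleR[OF this has_vector_derivative_const[of a]]
  show "((\<lambda>t. (2 * t) *\<^sub>R a + b) has_vector_derivative 2 *\<^sub>R a) (at 0)"
    by (auto intro!: derivative_eq_intros)
qed auto

lemma sum_partial_deriv_eq_frechet_derivative:
  fixes g :: "real ^ 'n::finite \<Rightarrow> real ^ 'n"
  assumes "g differentiable (at \<xi>)"
  shows "(\<Sum>j\<in>UNIV. partial_deriv j (\<lambda>\<eta>. g \<eta> $ i) \<xi> * v $ j) = frechet_derivative g (at \<xi>) v $ i"
proof -
  let ?D = "frechet_derivative g (at \<xi>)"
  have D: "(g has_derivative ?D) (at \<xi>)" using assms frechet_derivative_works by blast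
  then have lin: "linear ?D" by (rule has_derivative_linear)
  have p: "partial_deriv j (\<lambda>\<eta>. g \<eta> $ i) \<xi> = ?D (axis j 1) $ i" for j
  proof -
    have "((\<lambda>h. \<xi> + h *\<^sub>R axis j 1) has_vector_derivative axis j 1) (at 0)"
      by (auto intro!: derivative_eq_intros)
    from has_vector_derivative_compose_frechet[OF this, of g] assms
    have "((\<lambda>h. g (\<xi> + h *\<^sub>R axis j 1)) has_vector_derivative ?D (axis j 1)) (at 0)" by simp
    from bounded_linear.has_vector_derivative[OF bounded_linear_vec_nth this]
    have "((\<lambda>h. g (\<xi> + h *\<^sub>R axis j 1) $ i) has_real_derivative ?D (axis j 1) $ i) (at 0)"
      by (simp add: has_real_derivative_iff_has_vector_derivative)
    then show ?thesis unfolding partial_deriv_def by (rule DERIV_imp_deriv)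
  qed
  have "?D v = ?D (\<Sum>j\<in>UNIV. v $ j *\<^sub>R axis j 1)"
    by (simp add: basis_expansion scalar_mult_eq_scaleR[symmetric])
  also have "\<dots> = (\<Sum>j\<in>UNIV. v $ j *\<^sub>R ?D (axis j 1))"
    by (simp add: linear_sum[OF lin] linear_scale[OF lin])
  finally show ?thesis by (simp add: p mult.commute)
qed

section \<open>Integral curves on a manifold\<close>

lemma is_chartD:
  assumes "is_chart M (U, \<phi>)"
  shows "openin M U" "open (\<phi> ` U)" "inj_on \<phi> U" "U \<subseteq> topspace M"
    "continuous_map (subtopology M U) euclidean \<phi>"
    "continuous_map (top_of_set (\<phi> ` U)) M (inv_into U \<phi>)"
proof -
  show U: "openin M U" "open (\<phi> ` U)" using assms by (auto simp: is_chart_def)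
  then show UM: "U \<subseteq> topspace M" by (simp add: openin_subset)
  have h: "homeomorphic_map (subtopology M U) (top_of_set (\<phi> ` U)) \<phi>"
    using assms by (simp add: is_chart_def)
  then show inj: "inj_on \<phi> U"
    using homeomorphic_imp_injective_map UM by (fastforce simp: inf_absorb2)
  show "continuous_map (subtopology M U) euclidean \<phi>"
    using homeomorphic_imp_continuous_map[OF h] by (simp add: continuous_map_in_subtopology)
  obtain g where g: "homeomorphic_maps (subtopology M U) (top_of_set (\<phi> ` U)) \<phi> g"
    using h homeomorphic_map_maps by blast
  then have "continuous_map (top_of_set (\<phi> ` U)) M g"
    by (simp add: homeomorphic_maps_def continuous_map_in_subtopology)
  \<comment> \<open>The inverse supplied by the homeomorphism is determined only on the image of
    \<open>U\<close>, so it is replaced by \<open>inv_into\<close> there.\<close>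
  moreover have "g z = inv_into U \<phi> z" if "z \<in> \<phi> ` U" for z
    using g that UM inj by (auto simp: homeomorphic_maps_def inf_absorb2)
  ultimately show "continuous_map (top_of_set (\<phi> ` U)) M (inv_into U \<phi>)"
    by (auto elim: continuous_map_eq)
qed

lemma smooth_manifoldD:
  assumes "smooth_manifold M \<A>"
  shows "Hausdorff_space M" "(\<Union>c\<in>\<A>. fst c) = topspace M"
    "\<And>c. c \<in> \<A> \<Longrightarrow> is_chart M c"
    "\<And>c c'. c \<in> \<A> \<Longrightarrow> c' \<in> \<A> \<Longrightarrow> compatible c c'"
proof -
  note M = assms[unfolded smooth_manifold_def]
  show "Hausdorff_space M" using M by (elim conjE)
  show "(\<Union>c\<in>\<A>. fst c) = topspace M" using M by (elim conjE)
  show "is_chart M c" if "c \<in> \<A>" for c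
    using M that by (elim conjE) (erule (1) bspec)
  show "compatible c c'" if "c \<in> \<A>" "c' \<in> \<A>" for c c'
    using M that by (elim conjE) (drule (1) bspec, erule (1) bspec)
qed

lemma smooth_vector_field_Ck_on:
  assumes "smooth_vector_field M \<A> X" "(U, \<phi>) \<in> \<A>"
  shows "Ck_on (\<phi> ` U) (chart_components X (U, \<phi>)) k"
proof -
  have "smooth_on (snd (U, \<phi>) ` fst (U, \<phi>)) (chart_components X (U, \<phi>))"
    using assms unfolding smooth_vector_field_def by blast
  then show ?thesis by (simp add: smooth_on_def)
qed

text \<open>\<open>has_velocity\<close> tests every chart around the point, not only the one in
  which the equation was solved. The chain rule through the transition map gives the velocity in
  another chart, and the transformation rule for tangent vectors identifies it with the components
  of \<open>X\<close>.\<close>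

lemma integral_curve_inv_chart:
  assumes M: "smooth_manifold M \<A>" and X: "smooth_vector_field M \<A> X" and c: "(U, \<phi>) \<in> \<A>"
    and y: "\<And>t. t \<in> ball 0 r \<Longrightarrow> y t \<in> \<phi> ` U"
      "\<And>t. t \<in> ball 0 r \<Longrightarrow> (y has_vector_derivative chart_components X (U, \<phi>) (y t)) (at t)"
  shows "integral_curve M \<A> X (ball 0 r) (\<lambda>t. inv_into U \<phi> (y t))"
  unfolding integral_curve_def
proof (intro conjI ballI)
  note U = is_chartD[OF smooth_manifoldD(3)[OF M c]]
  show "is_interval (ball (0::real) r)" by (simp add: is_interval_convex_1)
  have "continuous_on (ball 0 r) y"
    using y(2) by (intro continuous_at_imp_continuous_on ballI) (rule has_vector_derivative_continuous)
  then have "continuous_map (top_of_set (ball 0 r)) (top_of_set (\<phi> ` U)) y"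
    using y(1) by (auto simp: continuous_map_in_subtopology)
  from continuous_map_compose[OF this U(6)]
  show "continuous_map (top_of_set (ball 0 r)) M (\<lambda>t. inv_into U \<phi> (y t))" by (simp add: o_def)
  fix t :: real assume t: "t \<in> ball 0 r"
  let ?p = "inv_into U \<phi> (y t)"
  have p: "?p \<in> U" "\<phi> ?p = y t" using y(1)[OF t] by (auto simp: inv_into_into f_inv_into_f)
  show "has_velocity \<A> (\<lambda>t. inv_into U \<phi> (y t)) (X ?p) t"
    unfolding has_velocity_def
  proof (intro ballI impI)
    fix c' assume c': "c' \<in> \<A>" "?p \<in> fst c'"
    let ?T = "transition (U, \<phi>) c'"
    have "compatible (U, \<phi>) c'" using smooth_manifoldD(4)[OF M c] c' by blast
    then have "Ck_on (\<phi> ` (U \<inter> fst c')) ?T (Suc 0)"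
      unfolding compatible_def smooth_on_def fst_conv snd_conv by blast
    moreover have "y t \<in> \<phi> ` (U \<inter> fst c')" using p c' by (auto intro!: image_eqI[of _ _ ?p])
    ultimately have "?T differentiable (at (y t))" by auto
    from has_vector_derivative_compose_frechet[OF y(2)[OF t] this]
    have "((\<lambda>t. ?T (y t)) has_vector_derivative
        frechet_derivative ?T (at (y t)) (X ?p (U, \<phi>))) (at t)"
      by (simp add: chart_components_def)
    moreover have tv: "tangent_vector \<A> ?p (X ?p)"
      using X p(1) U(4) unfolding smooth_vector_field_def by blast
    have "X ?p c' = frechet_derivative ?T (at (y t)) (X ?p (U, \<phi>))"
      using tv[unfolded tangent_vector_def, rule_format, OF c c'(1)] p c'(2) by simp
    ultimately show "(snd c' \<circ> (\<lambda>t. inv_into U \<phi> (y t)) has_vector_derivative X ?p c') (at t)"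
      by (simp add: transition_def o_def)
  qed
qed auto

lemma integral_curve_in_chart:
  assumes M: "smooth_manifold M \<A>" and c: "(U, \<phi>) \<in> \<A>"
    and \<sigma>: "integral_curve M \<A> X J \<sigma>" and s: "s \<in> J" "\<sigma> s \<in> U"
  obtains e where "0 < e" "ball s e \<subseteq> J" "\<And>t. t \<in> ball s e \<Longrightarrow> \<sigma> t \<in> U"
    "\<And>t. t \<in> ball s e \<Longrightarrow>
      ((\<lambda>t. \<phi> (\<sigma> t)) has_vector_derivative chart_components X (U, \<phi>) (\<phi> (\<sigma> t))) (at t)"
proof -
  note U = is_chartD[OF smooth_manifoldD(3)[OF M c]]
  have J: "open J" and cont: "continuous_map (top_of_set J) M \<sigma>"
    and vel: "\<And>t. t \<in> J \<Longrightarrow> has_velocity \<A> \<sigma> (X (\<sigma> t)) t"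
    using \<sigma> by (auto simp: integral_curve_def)
  have "openin (top_of_set J) {t \<in> J. \<sigma> t \<in> U}"
    using openin_continuous_map_preimage[OF cont U(1)] by simp
  then have "open {t \<in> J. \<sigma> t \<in> U}" using J openin_open_trans by blast
  then obtain e where e: "0 < e" "ball s e \<subseteq> {t \<in> J. \<sigma> t \<in> U}"
    using s open_contains_ball by blast
  show thesis
  proof (rule that[OF e(1)])
    fix t assume t: "t \<in> ball s e"
    then have tJ: "t \<in> J" "\<sigma> t \<in> U" using e by auto
    then show "\<sigma> t \<in> U" by simp
    have "((\<lambda>t. \<phi> (\<sigma> t)) has_vector_derivative X (\<sigma> t) (U, \<phi>)) (at t)"
      using vel[OF tJ(1)] c tJ(2) unfolding has_velocity_def o_def by fastforce
    then show "((\<lambda>t. \<phi> (\<sigma> t)) has_vector_derivative chart_components X (U, \<phi>) (\<phi> (\<sigma> t))) (at t)"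
      using U(3) tJ(2) by (simp add: chart_components_def)
  qed (use e in auto)
qed

text \<open>In a chart the difference of the two curves satisfies |d'| <= L |d| and vanishes at
  \<open>s\<close>, so \<open>short_time_gronwall\<close> with \<open>k = 0\<close> forces it to be
  0; injectivity of the chart carries this back to the manifold.\<close>

lemma integral_curve_locally_unique:
  assumes M: "smooth_manifold M \<A>" and X: "smooth_vector_field M \<A> X"
    and \<sigma>: "integral_curve M \<A> X J \<sigma>" and \<tau>: "integral_curve M \<A> X J' \<tau>"
    and s: "s \<in> J" "s \<in> J'" "\<sigma> s = \<tau> s"
  obtains e where "0 < e" "ball s e \<subseteq> J \<inter> J'" "\<And>t. t \<in> ball s e \<Longrightarrow> \<sigma> t = \<tau> t"
proof -
  have "\<sigma> s \<in> topspace M"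
    using \<sigma> s(1) by (auto simp: integral_curve_def continuous_map_def)
  then obtain U \<phi> where c: "(U, \<phi>) \<in> \<A>" and sU: "\<sigma> s \<in> U"
    using smooth_manifoldD(2)[OF M] by fastforce
  note U = is_chartD[OF smooth_manifoldD(3)[OF M c]]
  let ?F = "chart_components X (U, \<phi>)"
  have F: "Ck_on (\<phi> ` U) ?F (Suc 0)"
    using smooth_vector_field_Ck_on[OF X c] .
  obtain R where R: "0 < R" "cball (\<phi> (\<sigma> s)) R \<subseteq> \<phi> ` U"
    using U(2) sU open_contains_cball by blast
  let ?C = "cball (\<phi> (\<sigma> s)) R"
  obtain L where L: "0 \<le> L"
    and lip: "\<And>x z. x \<in> ?C \<Longrightarrow> z \<in> ?C \<Longrightarrow> norm (?F x - ?F z) \<le> L * norm (x - z)"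
    using Ck_on_lipschitz_bound[OF F compact_cball convex_cball R(2)] by metis
  have near: "\<exists>e>0. \<forall>t\<in>ball s e. t \<in> I \<and> \<rho> t \<in> U \<and> \<phi> (\<rho> t) \<in> ?C \<and>
      ((\<lambda>t. \<phi> (\<rho> t)) has_vector_derivative ?F (\<phi> (\<rho> t))) (at t)"
    if \<rho>: "integral_curve M \<A> X I \<rho>" "s \<in> I" "\<rho> s = \<sigma> s" for I \<rho>
  proof -
    obtain e where e: "0 < e" "ball s e \<subseteq> I" "\<And>t. t \<in> ball s e \<Longrightarrow> \<rho> t \<in> U"
      "\<And>t. t \<in> ball s e \<Longrightarrow> ((\<lambda>t. \<phi> (\<rho> t)) has_vector_derivative ?F (\<phi> (\<rho> t))) (at t)"
      using integral_curve_in_chart[OF M c \<rho>(1,2)] \<rho>(3) sU by metis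
    have "isCont (\<lambda>t. \<phi> (\<rho> t)) s"
      using e(4)[of s] e(1) has_vector_derivative_continuous by auto
    then obtain d where d: "0 < d" "\<And>t. t \<in> ball s d \<Longrightarrow> dist (\<phi> (\<rho> t)) (\<phi> (\<sigma> s)) < R"
      using R(1) \<rho>(3) unfolding continuous_at_eps_delta by (metis dist_commute mem_ball)
    show ?thesis
    proof (intro exI[of _ "min d e"] conjI ballI)
      fix t assume t: "t \<in> ball s (min d e)"
      then have te: "t \<in> ball s e" "t \<in> ball s d" by auto
      show "t \<in> I" "\<rho> t \<in> U" "((\<lambda>t. \<phi> (\<rho> t)) has_vector_derivative ?F (\<phi> (\<rho> t))) (at t)"
        using e te by auto
      show "\<phi> (\<rho> t) \<in> ?C" using d(2)[OF te(2)] by (simp add: dist_commute)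
    qed (use d e in auto)
  qed
  obtain e1 where e1: "0 < e1" "\<And>t. t \<in> ball s e1 \<Longrightarrow> t \<in> J \<and> \<sigma> t \<in> U \<and> \<phi> (\<sigma> t) \<in> ?C \<and>
      ((\<lambda>t. \<phi> (\<sigma> t)) has_vector_derivative ?F (\<phi> (\<sigma> t))) (at t)"
    using near[OF \<sigma> s(1)] by blast
  obtain e2 where e2: "0 < e2" "\<And>t. t \<in> ball s e2 \<Longrightarrow> t \<in> J' \<and> \<tau> t \<in> U \<and> \<phi> (\<tau> t) \<in> ?C \<and>
      ((\<lambda>t. \<phi> (\<tau> t)) has_vector_derivative ?F (\<phi> (\<tau> t))) (at t)"
    using near[OF \<tau> s(2)] s(3) by auto
  define e where "e = min (min e1 e2) (1 / (2 * (L + 1)))"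
  have e: "0 < e" "e \<le> e1" "e \<le> e2" using e1(1) e2(1) L by (auto simp: e_def)
  have "e * L \<le> 1 / (2 * (L + 1)) * L" using L by (intro mult_right_mono) (auto simp: e_def)
  also have "\<dots> \<le> 1 / 2" using L by (simp add: field_simps)
  finally have eL: "e * L \<le> 1 / 2" .
  have in_ball: "t \<in> ball s e1" "t \<in> ball s e2" if "t \<in> ball s e" for t using that e by auto
  show thesis
  proof (rule that[OF e(1)])
    show "ball s e \<subseteq> J \<inter> J'" using e1(2) e2(2) in_ball by blast
    fix t assume t: "t \<in> ball s e"
    have "norm (\<phi> (\<sigma> t) - \<phi> (\<tau> t)) \<le> 2 * (norm (\<phi> (\<sigma> s) - \<phi> (\<tau> s)) + e * 0)"
    proof (rule short_time_gronwall[where L = L and d' = "\<lambda>t. ?F (\<phi> (\<sigma> t)) - ?F (\<phi> (\<tau> t))"])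
      fix t assume "t \<in> ball s e"
      note t = e1(2)[OF in_ball(1)[OF this]] e2(2)[OF in_ball(2)[OF this]]
      show "((\<lambda>t. \<phi> (\<sigma> t) - \<phi> (\<tau> t)) has_vector_derivative ?F (\<phi> (\<sigma> t)) - ?F (\<phi> (\<tau> t))) (at t)"
        using t by (intro has_vector_derivative_diff) auto
      show "norm (?F (\<phi> (\<sigma> t)) - ?F (\<phi> (\<tau> t))) \<le> L * norm (\<phi> (\<sigma> t) - \<phi> (\<tau> t)) + 0"
        using t lip by simp
    next
      have "norm (\<phi> (\<sigma> t) - \<phi> (\<tau> t)) \<le> R + R" if "t \<in> ball s e" for t
        using e1(2)[OF in_ball(1)[OF that]] e2(2)[OF in_ball(2)[OF that]]
          dist_triangle_le[of "\<phi> (\<sigma> t)" "\<phi> (\<sigma> s)" "\<phi> (\<tau> t)" "R + R"]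
        by (auto simp: dist_norm norm_minus_commute)
      then show "bounded ((\<lambda>t. \<phi> (\<sigma> t) - \<phi> (\<tau> t)) ` ball s e)"
        by (intro boundedI[of _ "R + R"]) auto
    qed (use L eL t in auto)
    then have "\<phi> (\<sigma> t) = \<phi> (\<tau> t)" using s(3) by simp
    then show "\<sigma> t = \<tau> t"
      using U(3) e1(2)[OF in_ball(1)[OF t]] e2(2)[OF in_ball(2)[OF t]] by (meson inj_onD)
  qed
qed

text \<open>The set of times at which the curves agree is closed by the Hausdorff property, open by
  local uniqueness, and contains \<open>s\<close>; the common interval is connected.\<close>

lemma integral_curve_unique:
  assumes M: "smooth_manifold M \<A>" and X: "smooth_vector_field M \<A> X"
    and \<sigma>: "integral_curve M \<A> X J \<sigma>" and \<tau>: "integral_curve M \<A> X J' \<tau>"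
    and s: "s \<in> J \<inter> J'" "\<sigma> s = \<tau> s" and t: "t \<in> J \<inter> J'"
  shows "\<sigma> t = \<tau> t"
proof -
  let ?I = "J \<inter> J'"
  let ?E = "{t \<in> ?I. \<sigma> t = \<tau> t}"
  have "is_interval ?I" using \<sigma> \<tau> by (auto simp: integral_curve_def is_interval_Int)
  then have "connected ?I" by (rule is_interval_connected)
  have "continuous_map (top_of_set ?I) M \<sigma>" "continuous_map (top_of_set ?I) M \<tau>"
    using \<sigma> \<tau> by (auto simp: integral_curve_def intro: continuous_map_from_subtopology_mono)
  then have "closedin (top_of_set ?I) ?E"
    using closedin_continuous_maps_eq[OF smooth_manifoldD(1)[OF M], of "top_of_set ?I" \<sigma> \<tau>]
    by simp
  moreover have "open ?E"
    unfolding open_contains_ball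
  proof
    fix t assume "t \<in> ?E"
    then obtain e where "0 < e" "ball t e \<subseteq> ?I" "\<And>t'. t' \<in> ball t e \<Longrightarrow> \<sigma> t' = \<tau> t'"
      using integral_curve_locally_unique[OF M X \<sigma> \<tau>, of t] by blast
    then show "\<exists>e>0. ball t e \<subseteq> ?E" by blast
  qed
  then have "openin (top_of_set ?I) ?E" by (intro open_subset) auto
  ultimately have "?E = {} \<or> ?E = ?I" using \<open>connected ?I\<close> by (auto simp: connected_clopen)
  then show ?thesis using s t by blast
qed

text \<open>Any integral curve reaching time \<open>s\<close>, whatever its lifetime, thus evaluates
  the definite description in \<open>flow\<close>.\<close>

lemma flow_eqI:
  assumes "smooth_manifold M \<A>" "smooth_vector_field M \<A> X" and y: "flows_to M \<A> X s x y"
  shows "flow M \<A> X s x = y"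
  unfolding flow_def
proof (rule the_equality[of "flows_to M \<A> X s x", OF y])
  fix z assume z: "flows_to M \<A> X s x z"
  obtain J \<sigma> where \<sigma>: "integral_curve M \<A> X J \<sigma>" "0 \<in> J" "s \<in> J" "\<sigma> 0 = x" "\<sigma> s = y"
    using y unfolding flows_to_def by blast
  obtain J' \<tau> where \<tau>: "integral_curve M \<A> X J' \<tau>" "0 \<in> J'" "s \<in> J'" "\<tau> 0 = x" "\<tau> s = z"
    using z unfolding flows_to_def by blast
  have "\<sigma> s = \<tau> s"
    by (rule integral_curve_unique[OF assms(1,2) \<sigma>(1) \<tau>(1), of 0]) (use \<sigma> \<tau> in auto)
  then show "z = y" using \<sigma> \<tau> by simp
qed

section \<open>Return from the chart to the manifold\<close>

theorem lemma2:
  fixes M :: "'a topology"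
    and \<A> :: "('a, 'n::finite) chart set"
    and A B :: "'a \<Rightarrow> ('a, 'n) tangent"
    and \<gamma> :: "'a \<Rightarrow> real \<Rightarrow> 'a"
    and U :: "'a set" and \<phi> :: "'a \<Rightarrow> real ^ 'n"
    and Ac Bc a b :: "real ^ 'n \<Rightarrow> real ^ 'n"
  assumes "smooth_manifold M \<A>"
    and "smooth_vector_field M \<A> A"
    and "smooth_vector_field M \<A> B"
    and "\<And>x t. \<gamma> x t = flow M \<A> A (t\<^sup>2) (flow M \<A> B t x)"
    and "(U, \<phi>) \<in> \<A>"
    and "Ac = chart_components A (U, \<phi>)"
    and "Bc = chart_components B (U, \<phi>)"
    and "\<And>\<xi> i. a \<xi> $ i =
      Ac \<xi> $ i + 1 / 2 * (\<Sum>j\<in>UNIV. partial_deriv j (\<lambda>\<eta>. Bc \<eta> $ i) \<xi> * Bc \<xi> $ j)"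
    and "\<And>\<xi> i. b \<xi> $ i = Bc \<xi> $ i"
  shows "\<forall>x\<in>U.
    (\<forall>\<^sub>F t in nhds 0. (t, x) \<in> flow_domain M \<A> B \<and>
       (t\<^sup>2, flow M \<A> B t x) \<in> flow_domain M \<A> A \<and> \<gamma> x t \<in> U) \<and>
    same_2jet (\<lambda>t. \<phi> (\<gamma> x t)) (\<lambda>t. \<phi> x + t\<^sup>2 *\<^sub>R a (\<phi> x) + t *\<^sub>R b (\<phi> x))"
proof
  fix x assume x: "x \<in> U"
  note M = assms(1) and A = assms(2) and B = assms(3) and \<gamma> = assms(4) and c = assms(5)
  note U = is_chartD[OF smooth_manifoldD(3)[OF M c]]
  have sA: "Ck_on (\<phi> ` U) Ac (Suc (Suc 0))"
    using smooth_vector_field_Ck_on[OF A c] unfolding assms(6) .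
  have sB: "Ck_on (\<phi> ` U) Bc (Suc 0)"
    using smooth_vector_field_Ck_on[OF B c] unfolding assms(7) .
  have \<phi>x: "\<phi> x \<in> \<phi> ` U" using x by simp
  obtain r y u where r: "0 < r" "r \<le> 1" and y0: "y 0 = \<phi> x"
    and y: "\<And>t. t \<in> ball 0 r \<Longrightarrow> y t \<in> \<phi> ` U \<and> (y has_vector_derivative Bc (y t)) (at t)"
    and u0: "\<And>t. t \<in> ball 0 r \<Longrightarrow> u t 0 = y t"
    and u: "\<And>t s. t \<in> ball 0 r \<Longrightarrow> s \<in> ball 0 r \<Longrightarrow>
      u t s \<in> \<phi> ` U \<and> (u t has_vector_derivative Ac (u t s)) (at s)"
    and taylor: "has_taylor2 (\<lambda>t. u t (t\<^sup>2)) (\<phi> x) (Bc (\<phi> x))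
      (Ac (\<phi> x) + (1 / 2) *\<^sub>R frechet_derivative Bc (at (\<phi> x)) (Bc (\<phi> x)))"
    by (rule flow_square_along_flow_taylor2[OF sA sB U(2) \<phi>x]) (rule that; assumption)
  let ?J = "ball (0::real) r"
  let ?i = "inv_into U \<phi>"
  have J0: "0 \<in> ?J" using r by simp
  \<comment> \<open>Pulled back through the inverse chart, the coordinate solutions witness that
    both flows are defined and, by uniqueness, are their values.\<close>
  have \<sigma>: "integral_curve M \<A> B ?J (\<lambda>t. ?i (y t))"
    by (rule integral_curve_inv_chart[OF M B c]) (use y assms(7) in auto)
  have \<tau>: "integral_curve M \<A> A ?J (\<lambda>s. ?i (u t s))" if "t \<in> ?J" for t
    by (rule integral_curve_inv_chart[OF M A c]) (use u[OF that] assms(6) in auto)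
  have ix: "?i (\<phi> x) = x" using x U(3) by simp
  have main: "(t, x) \<in> flow_domain M \<A> B \<and> (t\<^sup>2, flow M \<A> B t x) \<in> flow_domain M \<A> A \<and>
      \<gamma> x t \<in> U \<and> u t (t\<^sup>2) = \<phi> (\<gamma> x t)" if t: "t \<in> ?J" for t
  proof -
    have sq: "t\<^sup>2 \<in> ?J" using t r by (intro power2_in_ball)
    have B_flow: "flows_to M \<A> B t x (?i (y t))"
      unfolding flows_to_def using \<sigma> J0 t y0 ix by (intro exI[of _ ?J] exI conjI) auto
    have A_flow: "flows_to M \<A> A (t\<^sup>2) (?i (y t)) (?i (u t (t\<^sup>2)))"
      unfolding flows_to_def using \<tau>[OF t] J0 sq u0[OF t]
      by (intro exI[of _ ?J] exI[of _ "\<lambda>s. ?i (u t s)"] conjI) auto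
    have fB: "flow M \<A> B t x = ?i (y t)" using flow_eqI[OF M B B_flow] .
    have "\<gamma> x t = ?i (u t (t\<^sup>2))" using flow_eqI[OF M A A_flow] by (simp add: \<gamma> fB)
    then show ?thesis
      using B_flow A_flow fB u[OF t sq]
      by (auto simp: flow_domain_def inv_into_into f_inv_into_f)
  qed
  have near: "\<forall>\<^sub>F t in nhds 0. t \<in> ?J" using J0 by (intro eventually_nhds_in_open) auto
  have "Bc differentiable (at (\<phi> x))" using sB x by simp
  from sum_partial_deriv_eq_frechet_derivative[OF this]
  have a: "Ac (\<phi> x) + (1 / 2) *\<^sub>R frechet_derivative Bc (at (\<phi> x)) (Bc (\<phi> x)) = a (\<phi> x)"
    by (simp add: vec_eq_iff assms(8))
  have b: "Bc (\<phi> x) = b (\<phi> x)" by (simp add: vec_eq_iff assms(9))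
  \<comment> \<open>The curve \<open>\<phi> (\<gamma> x t)\<close> is identified with
    \<open>u t (t^2)\<close> only for t in \<open>?J\<close>, so the coefficients are transferred by
    equality near 0.\<close>
  have "has_taylor2 (\<lambda>t. \<phi> (\<gamma> x t)) (\<phi> x) (b (\<phi> x)) (a (\<phi> x))"
    by (rule has_taylor2_cong[OF taylor[unfolded a, unfolded b]]) (use near main in \<open>auto elim: eventually_mono\<close>)
  then have "same_2jet (\<lambda>t. \<phi> (\<gamma> x t)) (\<lambda>t. \<phi> x + t\<^sup>2 *\<^sub>R a (\<phi> x) + t *\<^sub>R b (\<phi> x))"
    unfolding same_2jet_def using has_taylor2_quadratic by blast
  moreover have "\<forall>\<^sub>F t in nhds 0. (t, x) \<in> flow_domain M \<A> B \<and>
       (t\<^sup>2, flow M \<A> B t x) \<in> flow_domain M \<A> A \<and> \<gamma> x t \<in> U"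
    using near by eventually_elim (use main in blast)
  ultimately show "(\<forall>\<^sub>F t in nhds 0. (t, x) \<in> flow_domain M \<A> B \<and>
       (t\<^sup>2, flow M \<A> B t x) \<in> flow_domain M \<A> A \<and> \<gamma> x t \<in> U) \<and>
    same_2jet (\<lambda>t. \<phi> (\<gamma> x t)) (\<lambda>t. \<phi> x + t\<^sup>2 *\<^sub>R a (\<phi> x) + t *\<^sub>R b (\<phi> x))" by blast
qed

end
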